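(* Let $T$ be a CCNC row contraction on a Hilbert space $\mathcal H$. The characteristic function $b_T$ of $T$ coincides weakly with the Sz.-Nagy-Foiaş characteristic function $$\Theta_T(z):=\big(-T+D_{T^*}(I-zT^* )^{-1}zD_T\big)\big|_{\overline{\mathrm{Ran}(D_T)}}\in\mathscr L\big(\overline{\mathrm{Ran}(D_T)},\overline{\mathrm{Ran}(D_{T^*})}\big),\qquad z\in\mathbb B^d.$$
   Context: Hilbert spaces are complex and separable (or finite-dimensional); $\mathbb B^d$ is the open unit ball of $\mathbb C^d$; $\bigvee$ is closed linear span. For $z\in\mathbb B^d$ and a Hilbert space $\mathcal H$, $z^*:\mathcal H\to\mathcal H\otimes\mathbb C^d$ is $z^*h=(\overline z_1h,\dots,\overline z_dh)^T$ and $z:=(z^* )^*:\mathcal H\otimes\mathbb C^d\to\mathcal H$. A row contraction on $\mathcal H$ is a contraction $T=(T_1,\dots,T_d):\mathcal H\otimes\mathbb C^d\to\mathcal H$; $Tz^*=\sum\overline z_jT_j$, $zT^*=\sum z_jT_j^*$. $D_T:=\sqrt{I-T^*T}$, $D_{T^*}:=\sqrt{I-TT^*}$. $T$ is CCNC if $\mathcal H=\bigvee_{z\in\mathbb B^d}(I-Tz^* )^{-1}\mathrm{Ran}(D_{T^*})$. Let $H^2_d$ be the Drury-Arveson space (kernel $1/(1-\sum z_j\overline w_j)$) and $\mathscr S_d(\mathcal J,\mathcal K)$ the set of contractive multipliers from $H^2_d\otimes\mathcal J$ to $H^2_d\otimes\mathcal K$. $b_1\in\mathscr S_d(\mathcal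 H_1,\mathcal J_1)$ and $b_2\in\mathscr S_d(\mathcal H_2,\mathcal J_2)$ coincide weakly if there is an onto isometry $U:\mathcal J_1\to\mathcal J_2$ with $Ub_1(z)b_1(w)^*U^*=b_2(z)b_2(w)^*$ for all $z,w\in\mathbb B^d$. Characteristic function. Every row contraction $T$ has an isometric-pure decomposition $T=V-C$, where $V:=TP_{\mathrm{Ker}(D_T)}$ is a row partial isometry and $\mathrm{Ker}(C)^\perp\subseteq\mathrm{Ker}(V)$, $\mathrm{Ran}(C)\subseteq\mathrm{Ran}(V)^\perp$; $T$ is CCNC iff $V$ is. For a CCNC row partial isometry $V$ put $\mathcal R(V-z):=(V-z)\mathrm{Ker}(V)^\perp$. A model triple $(\gamma,\mathcal J_\infty,\mathcal J_0)$ for $V$ consists of Hilbert spaces with $\dim\mathcal J_\infty=\dim\mathrm{Ker}(V)$, $\dim\mathcal J_0=\dim\mathrm{Ran}(V)^\perp$, and a map $\gamma$ on $\mathbb B^d\cup\{\infty\}$ with $\gamma(z)\in\mathscr L(\mathcal J_0,\mathcal R(V-z)^\perp)$ a linear isomorphism for each $z\in\mathbb B^d$, $\gamma(\infty)\in\mathscr L(\mathcal J_\infty,\mathrm{Ker}(V))$, and $\gamma(0),\gamma(\infty)$ onto isometries. Then $D^\gamma(z):=\gamma(z)^*\gamma(0)$ is invertible, and with $N^\gamma(z):=(\gamma(z)^*\otimes I_d)\gamma(\infty)$ one sets $b_V^\gamma(z):=D^\gamma(z)^{-1}zN^\gamma(z)\in\mathscr L(\mathcal J_\infty,\mathcal J_0)$.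 For $T=V-C$ CCNC let $\delta:=-\gamma(0)^*T\gamma(\infty)$ (a pure contraction, i.e. $\|\delta g\|<\|g\|$ for $g\ne0$) and $b_T^\gamma(z):=D_{\delta^*}^{-1}(b_V^\gamma(z)+\delta)(I+\delta^*b_V^\gamma(z))^{-1}D_\delta$ (its adjoint is initially defined on the dense subspace $\mathrm{Ran}(D_{\delta^*})$ and extended by continuity). The characteristic function $b_T$ of $T$ is the weak coincidence class of $b_T^\gamma\in\mathscr S_d(\mathcal J_\infty,\mathcal J_0)$ (independent of the model triple). *)

theory Defs
  imports "HOL-Analysis.Analysis"
begin

section \<open>Complex Hilbert spaces\<close>

text \<open>The inner product is linear in the first argument; the norm, distance and topology are
  those of \<^class>\<open>real_inner\<close>, whose real inner product is the real part of \<open>cinner\<close>.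
  Positive definiteness is inherited from there.\<close>

class complex_hilbert_space = real_inner + complete_space +
  fixes scaleC :: "complex \<Rightarrow> 'a \<Rightarrow> 'a" (infixr "*\<^sub>C" 75)
    and cinner :: "'a \<Rightarrow> 'a \<Rightarrow> complex"
  assumes scaleC_add_right: "a *\<^sub>C (x + y) = a *\<^sub>C x + a *\<^sub>C y"
    and scaleC_add_left: "(a + b) *\<^sub>C x = a *\<^sub>C x + b *\<^sub>C x"
    and scaleC_scaleC: "a *\<^sub>C b *\<^sub>C x = (a * b) *\<^sub>C x"
    and scaleC_of_real: "complex_of_real r *\<^sub>C x = r *\<^sub>R x"
    and cinner_add_left: "cinner (x + y) z = cinner x z + cinner y z"
    and cinner_scaleC_left: "cinner (a *\<^sub>C x) y = a * cinner x y"
    and cinner_commute: "cinner x y = cnj (cinner y x)"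
    and Re_cinner: "Re (cinner x y) = inner x y"

global_interpretation complex_vector:
  vector_space "scaleC :: complex \<Rightarrow> 'a \<Rightarrow> 'a::complex_hilbert_space"
  defines cspan = complex_vector.span
proof
  fix x :: 'a
  show "1 *\<^sub>C x = x"
    using scaleC_of_real[of 1 x] by simp
qed (simp_all add: scaleC_add_right scaleC_add_left scaleC_scaleC)

instantiation complex :: complex_hilbert_space
begin

definition scaleC_complex :: "complex \<Rightarrow> complex \<Rightarrow> complex"
  where "scaleC_complex a x = a * x"

definition cinner_complex :: "complex \<Rightarrow> complex \<Rightarrow> complex"
  where "cinner_complex x y = x * cnj y"

instance
  by standard
    (simp_all add: scaleC_complex_def cinner_complex_def algebra_simps scaleR_conv_of_real
      inner_complex_def)

end

text \<open>\<open>'a ^ 'd\<close> is the Hilbert space tensor product of \<open>'a\<close> with \<open>\<complex>\<^sup>d\<close>, \<open>d = CARD('d)\<close>.\<close>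

instantiation vec :: (complex_hilbert_space, finite) complex_hilbert_space
begin

definition scaleC_vec :: "complex \<Rightarrow> 'a ^ 'b \<Rightarrow> 'a ^ 'b"
  where "scaleC_vec a x = (\<chi> j. a *\<^sub>C (x $ j))"

definition cinner_vec :: "'a ^ 'b \<Rightarrow> 'a ^ 'b \<Rightarrow> complex"
  where "cinner_vec x y = (\<Sum>j\<in>UNIV. cinner (x $ j) (y $ j))"

instance
proof
  fix x y :: "'a ^ 'b"
  show "cinner x y = cnj (cinner y x)"
    unfolding cinner_vec_def cnj_sum by (rule sum.cong) (simp_all add: cinner_commute[symmetric])
qed (simp_all add: scaleC_vec_def cinner_vec_def vec_eq_iff scaleC_add_right scaleC_add_left
    scaleC_scaleC scaleC_of_real cinner_add_left cinner_scaleC_left sum.distrib sum_distrib_left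
    inner_vec_def Re_cinner)

end

section \<open>Operators between closed subspaces\<close>

text \<open>A Hilbert space is either a type or a closed subspace of a type. An operator from \<open>X\<close> to \<open>Y\<close>
  is a function on the ambient types of which only the values on \<open>X\<close> matter.\<close>

definition bounded_ops ::
  "'a::complex_hilbert_space set \<Rightarrow> 'b::complex_hilbert_space set \<Rightarrow> ('a \<Rightarrow> 'b) set"
  where "bounded_ops X Y = {A.
    (\<forall>x\<in>X. A x \<in> Y) \<and>
    (\<forall>x\<in>X. \<forall>y\<in>X. A (x + y) = A x + A y) \<and>
    (\<forall>c. \<forall>x\<in>X. A (c *\<^sub>C x) = c *\<^sub>C A x) \<and>
    (\<exists>K. \<forall>x\<in>X. norm (A x) \<le> K * norm x)}"

definition adj_on ::
  "'a::complex_hilbert_space set \<Rightarrow> ('a \<Rightarrow> 'b::complex_hilbert_space) \<Rightarrow> 'b \<Rightarrow> 'a"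
  where "adj_on X A y = (THE x. x \<in> X \<and> (\<forall>u\<in>X. cinner (A u) y = cinner u x))"

abbreviation adj :: "('a::complex_hilbert_space \<Rightarrow> 'b::complex_hilbert_space) \<Rightarrow> 'b \<Rightarrow> 'a"
  where "adj A \<equiv> adj_on UNIV A"

definition onto_isometry ::
  "'a::complex_hilbert_space set \<Rightarrow> 'b::complex_hilbert_space set \<Rightarrow> ('a \<Rightarrow> 'b) \<Rightarrow> bool"
  where "onto_isometry X Y U \<longleftrightarrow>
    U \<in> bounded_ops X Y \<and> (\<forall>x\<in>X. norm (U x) = norm x) \<and> U ` X = Y"

definition kernel :: "('a::complex_hilbert_space \<Rightarrow> 'b::complex_hilbert_space) \<Rightarrow> 'a set"
  where "kernel A = {x. A x = 0}"

definition ortho :: "'a::complex_hilbert_space set \<Rightarrow> 'a set"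
  where "ortho S = {x. \<forall>y\<in>S. cinner x y = 0}"

definition proj :: "'a::complex_hilbert_space set \<Rightarrow> 'a \<Rightarrow> 'a"
  where "proj M x = (THE y. y \<in> M \<and> x - y \<in> ortho M)"

definition positive_op :: "('a::complex_hilbert_space \<Rightarrow> 'a) \<Rightarrow> bool"
  where "positive_op A \<longleftrightarrow>
    A \<in> bounded_ops UNIV UNIV \<and> (\<forall>x. cinner (A x) x \<in> \<real>\<^sub>\<ge>\<^sub>0)"

definition sqrt_op :: "('a::complex_hilbert_space \<Rightarrow> 'a) \<Rightarrow> 'a \<Rightarrow> 'a"
  where "sqrt_op A = (THE B. positive_op B \<and> B \<circ> B = A)"

text \<open>\<open>defect A\<close> is \<open>D\<^sub>A\<close> and \<open>defect_star A\<close> is \<open>D\<^sub>A\<^sub>*\<close>.\<close>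

definition defect :: "('a::complex_hilbert_space \<Rightarrow> 'b::complex_hilbert_space) \<Rightarrow> 'a \<Rightarrow> 'a"
  where "defect A = sqrt_op (\<lambda>x. x - adj A (A x))"

definition defect_star :: "('a::complex_hilbert_space \<Rightarrow> 'b::complex_hilbert_space) \<Rightarrow> 'b \<Rightarrow> 'b"
  where "defect_star A = sqrt_op (\<lambda>y. y - A (adj A y))"

definition orthonormal_basis :: "'a::complex_hilbert_space set \<Rightarrow> 'a set \<Rightarrow> bool"
  where "orthonormal_basis E X \<longleftrightarrow>
    (\<forall>e\<in>E. \<forall>f\<in>E. cinner e f = (if e = f then 1 else 0)) \<and> closure (cspan E) = X"

definition same_dim :: "'a::complex_hilbert_space set \<Rightarrow> 'b::complex_hilbert_space set \<Rightarrow> bool"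
  where "same_dim X Y \<longleftrightarrow>
    (\<exists>E F f. orthonormal_basis E X \<and> orthonormal_basis F Y \<and> bij_betw f E F)"

section \<open>The Drury--Arveson space and its contractive multipliers\<close>

text \<open>\<open>rkhs \<Omega> k J F ip\<close>: the set \<open>F\<close> of \<open>J\<close>-valued functions on \<open>\<Omega>\<close> (extended by \<open>0\<close> outside
  \<open>\<Omega>\<close>) with the inner product \<open>ip\<close> is the reproducing kernel Hilbert space with operator-valued
  kernel \<open>k(z,w) I\<^sub>J\<close>, that is, the tensor product with \<open>J\<close> of the scalar reproducing kernel
  Hilbert space with kernel \<open>k\<close>. By the Moore--Aronszajn theorem there is exactly one such space
  for every positive kernel \<open>k\<close>.\<close>

definition kernel_fun ::
  "'p set \<Rightarrow> ('p \<Rightarrow> 'p \<Rightarrow> complex) \<Rightarrow> 'p \<Rightarrow> 'a::complex_hilbert_space \<Rightarrow> 'p \<Rightarrow> 'a"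
  where "kernel_fun \<Omega> k w x = (\<lambda>z. if z \<in> \<Omega> then k z w *\<^sub>C x else 0)"

definition rkhs ::
  "'p set \<Rightarrow> ('p \<Rightarrow> 'p \<Rightarrow> complex) \<Rightarrow> 'a::complex_hilbert_space set \<Rightarrow>
   ('p \<Rightarrow> 'a) set \<Rightarrow> (('p \<Rightarrow> 'a) \<Rightarrow> ('p \<Rightarrow> 'a) \<Rightarrow> complex) \<Rightarrow> bool"
  where "rkhs \<Omega> k J F ip \<longleftrightarrow>
    (\<forall>f\<in>F. (\<forall>z\<in>\<Omega>. f z \<in> J) \<and> (\<forall>z. z \<notin> \<Omega> \<longrightarrow> f z = 0)) \<and>
    (\<lambda>z. 0) \<in> F \<and>
    (\<forall>f\<in>F. \<forall>g\<in>F. (\<lambda>z. f z + g z) \<in> F) \<and>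
    (\<forall>c. \<forall>f\<in>F. (\<lambda>z. c *\<^sub>C f z) \<in> F) \<and>
    (\<forall>f\<in>F. \<forall>g\<in>F. \<forall>h\<in>F. ip (\<lambda>z. f z + g z) h = ip f h + ip g h) \<and>
    (\<forall>c. \<forall>f\<in>F. \<forall>g\<in>F. ip (\<lambda>z. c *\<^sub>C f z) g = c * ip f g) \<and>
    (\<forall>f\<in>F. \<forall>g\<in>F. ip f g = cnj (ip g f)) \<and>
    (\<forall>f\<in>F. 0 \<le> Re (ip f f) \<and> (ip f f = 0 \<longrightarrow> f = (\<lambda>z. 0))) \<and>
    (\<forall>u. (\<forall>n::nat. u n \<in> F) \<and>
      (\<forall>e>0. \<exists>N. \<forall>m\<ge>N. \<forall>n\<ge>N. Re (ip (\<lambda>z. u m z - u n z) (\<lambda>z. u m z - u n z)) < e) \<longrightarrow>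
      (\<exists>f\<in>F. (\<lambda>n. Re (ip (\<lambda>z. u n z - f z) (\<lambda>z. u n z - f z))) \<longlonglongrightarrow> 0)) \<and>
    (\<forall>w\<in>\<Omega>. \<forall>x\<in>J. kernel_fun \<Omega> k w x \<in> F \<and>
      (\<forall>f\<in>F. ip f (kernel_fun \<Omega> k w x) = cinner (f w) x))"

abbreviation unit_ball :: "(complex ^ 'd::finite) set"
  where "unit_ball \<equiv> ball 0 1"

definition da_kernel :: "complex ^ 'd::finite \<Rightarrow> complex ^ 'd \<Rightarrow> complex"
  where "da_kernel z w = 1 / (1 - (\<Sum>j\<in>UNIV. z $ j * cnj (w $ j)))"

definition multiply ::
  "(complex ^ 'd::finite \<Rightarrow> 'a \<Rightarrow> 'b::zero) \<Rightarrow> (complex ^ 'd \<Rightarrow> 'a) \<Rightarrow> complex ^ 'd \<Rightarrow> 'b"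
  where "multiply b f = (\<lambda>z. if z \<in> unit_ball then b z (f z) else 0)"

definition schur_class ::
  "'a::complex_hilbert_space set \<Rightarrow> 'b::complex_hilbert_space set \<Rightarrow>
   (complex ^ 'd::finite \<Rightarrow> 'a \<Rightarrow> 'b) set"
  where "schur_class J K = {b.
    (\<forall>z\<in>unit_ball. b z \<in> bounded_ops J K) \<and>
    (\<forall>F ipF G ipG.
      rkhs unit_ball da_kernel J F ipF \<and> rkhs unit_ball da_kernel K G ipG \<longrightarrow>
      (\<forall>f\<in>F. multiply b f \<in> G \<and>
        Re (ipG (multiply b f) (multiply b f)) \<le> Re (ipF f f)))}"

text \<open>\<open>b\<^sub>1\<close> maps \<open>H\<^sub>1\<close> to \<open>J\<^sub>1\<close>, \<open>b\<^sub>2\<close> maps \<open>H\<^sub>2\<close> to \<open>J\<^sub>2\<close>; the adjoints are those of operators between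
  these spaces.\<close>

definition coincide_weakly ::
  "'a::complex_hilbert_space set \<Rightarrow> 'b::complex_hilbert_space set \<Rightarrow>
   (complex ^ 'd::finite \<Rightarrow> 'a \<Rightarrow> 'b) \<Rightarrow>
   'e::complex_hilbert_space set \<Rightarrow> 'f::complex_hilbert_space set \<Rightarrow>
   (complex ^ 'd \<Rightarrow> 'e \<Rightarrow> 'f) \<Rightarrow> bool"
  where "coincide_weakly H1 J1 b1 H2 J2 b2 \<longleftrightarrow>
    b1 \<in> schur_class H1 J1 \<and> b2 \<in> schur_class H2 J2 \<and>
    (\<exists>U. onto_isometry J1 J2 U \<and>
      (\<forall>z\<in>unit_ball. \<forall>w\<in>unit_ball. \<forall>y\<in>J2.
        U (b1 z (adj_on H1 (b1 w) (adj_on J1 U y))) = b2 z (adj_on H2 (b2 w) y)))"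

section \<open>Row contractions\<close>

definition col :: "complex ^ 'd::finite \<Rightarrow> 'a::complex_hilbert_space \<Rightarrow> 'a ^ 'd"
  where "col z h = (\<chi> j. cnj (z $ j) *\<^sub>C h)"

definition row :: "complex ^ 'd::finite \<Rightarrow> 'a::complex_hilbert_space ^ 'd \<Rightarrow> 'a"
  where "row z = adj (col z)"

lemma row_eq: "row z x = (\<Sum>j\<in>UNIV. z $ j *\<^sub>C (x $ j))"
proof -
  have scale_right: "cinner u (c *\<^sub>C v) = cnj c * cinner u v" for u v :: 'a and c
    by (metis cinner_commute cinner_scaleC_left complex_cnj_mult)
  have add_right: "cinner u (v + w) = cinner u v + cinner u w" for u v w :: 'a
    by (metis cinner_add_left cinner_commute complex_cnj_add)
  have zero_right: "cinner u 0 = 0" for u :: 'a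
    using add_right[of u 0 0] by simp
  have sum_right: "cinner u (sum g S) = (\<Sum>j\<in>S. cinner u (g j))"
    if "finite S" for u :: 'a and g :: "'b \<Rightarrow> 'a" and S
    using that by (induction S) (simp_all add: add_right zero_right)
  have eq: "cinner (col z u) x = cinner u (\<Sum>j\<in>UNIV. z $ j *\<^sub>C (x $ j))" for u
    by (simp add: col_def cinner_vec_def sum_right scale_right cinner_scaleC_left)
  show ?thesis
    unfolding row_def adj_on_def
  proof (rule the_equality)
    fix y
    assume "y \<in> UNIV \<and> (\<forall>u\<in>UNIV. cinner (col z u) x = cinner u y)"
    then have "inner u y = inner u (\<Sum>j\<in>UNIV. z $ j *\<^sub>C (x $ j))" for u
      by (metis Re_cinner UNIV_I eq)
    then show "y = (\<Sum>j\<in>UNIV. z $ j *\<^sub>C (x $ j))"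
      by (metis inner_commute vector_eq_rdot)
  qed (simp add: eq)
qed

definition row_contraction :: "('h::complex_hilbert_space ^ 'd::finite \<Rightarrow> 'h) \<Rightarrow> bool"
  where "row_contraction T \<longleftrightarrow> T \<in> bounded_ops UNIV UNIV \<and> (\<forall>x. norm (T x) \<le> norm x)"

definition ccnc :: "('h::complex_hilbert_space ^ 'd::finite \<Rightarrow> 'h) \<Rightarrow> bool"
  where "ccnc T \<longleftrightarrow>
    closure (cspan (\<Union>z\<in>unit_ball. inv (\<lambda>h. h - T (col z h)) ` range (defect_star T))) = UNIV"

text \<open>The partial isometry \<open>V\<close> of the isometric-pure decomposition \<open>T = V - C\<close>.\<close>

definition isometric_part ::
  "('h::complex_hilbert_space ^ 'd::finite \<Rightarrow> 'h) \<Rightarrow> 'h ^ 'd \<Rightarrow> 'h"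
  where "isometric_part T = (\<lambda>x. T (proj (kernel (defect T)) x))"

section \<open>Characteristic functions\<close>

definition range_minus ::
  "('h::complex_hilbert_space ^ 'd::finite \<Rightarrow> 'h) \<Rightarrow> complex ^ 'd \<Rightarrow> 'h set"
  where "range_minus V z = (\<lambda>x. V x - row z x) ` ortho (kernel V)"

text \<open>The map \<open>\<gamma>\<close> on the ball together with the point \<open>\<infinity>\<close> is split into its restriction \<open>\<gamma>\<close> to the
  ball and its value \<open>\<gamma>i\<close> at \<open>\<infinity>\<close>. The Hilbert spaces \<open>J\<^sub>\<infinity>\<close> and \<open>J\<^sub>0\<close> are the types \<open>'i\<close> and \<open>'j\<close>.
  The values \<open>\<gamma> z\<close> and \<open>\<gamma>i\<close> are regarded as operators into the ambient spaces \<open>'h\<close> and \<open>'h ^ 'd\<close>,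
  so that their adjoints are defined everywhere, as needed in \<open>dgam\<close> and \<open>ngam\<close>.\<close>

definition model_triple ::
  "('h::complex_hilbert_space ^ 'd::finite \<Rightarrow> 'h) \<Rightarrow>
   (complex ^ 'd \<Rightarrow> 'j::complex_hilbert_space \<Rightarrow> 'h) \<Rightarrow>
   ('i::complex_hilbert_space \<Rightarrow> 'h ^ 'd) \<Rightarrow> bool"
  where "model_triple V \<gamma> \<gamma>i \<longleftrightarrow>
    same_dim (UNIV :: 'i set) (kernel V) \<and>
    same_dim (UNIV :: 'j set) (ortho (range V)) \<and>
    (\<forall>z\<in>unit_ball. \<gamma> z \<in> bounded_ops UNIV (ortho (range_minus V z)) \<and>
      bij_betw (\<gamma> z) UNIV (ortho (range_minus V z))) \<and>
    onto_isometry UNIV (ortho (range_minus V 0)) (\<gamma> 0) \<and>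
    onto_isometry UNIV (kernel V) \<gamma>i"

definition dgam ::
  "(complex ^ 'd::finite \<Rightarrow> 'j::complex_hilbert_space \<Rightarrow> 'h::complex_hilbert_space) \<Rightarrow>
   complex ^ 'd \<Rightarrow> 'j \<Rightarrow> 'j"
  where "dgam \<gamma> z = adj (\<gamma> z) \<circ> \<gamma> 0"

definition ngam ::
  "(complex ^ 'd::finite \<Rightarrow> 'j::complex_hilbert_space \<Rightarrow> 'h::complex_hilbert_space) \<Rightarrow>
   ('i::complex_hilbert_space \<Rightarrow> 'h ^ 'd) \<Rightarrow> complex ^ 'd \<Rightarrow> 'i \<Rightarrow> 'j ^ 'd"
  where "ngam \<gamma> \<gamma>i z = (\<lambda>g. \<chi> k. adj (\<gamma> z) (\<gamma>i g $ k))"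

definition char_fun_V ::
  "(complex ^ 'd::finite \<Rightarrow> 'j::complex_hilbert_space \<Rightarrow> 'h::complex_hilbert_space) \<Rightarrow>
   ('i::complex_hilbert_space \<Rightarrow> 'h ^ 'd) \<Rightarrow> complex ^ 'd \<Rightarrow> 'i \<Rightarrow> 'j"
  where "char_fun_V \<gamma> \<gamma>i z = inv (dgam \<gamma> z) \<circ> row z \<circ> ngam \<gamma> \<gamma>i z"

definition delta ::
  "('h::complex_hilbert_space ^ 'd::finite \<Rightarrow> 'h) \<Rightarrow>
   (complex ^ 'd \<Rightarrow> 'j::complex_hilbert_space \<Rightarrow> 'h) \<Rightarrow>
   ('i::complex_hilbert_space \<Rightarrow> 'h ^ 'd) \<Rightarrow> 'i \<Rightarrow> 'j"
  where "delta T \<gamma> \<gamma>i = (\<lambda>g. - adj (\<gamma> 0) (T (\<gamma>i g)))"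

text \<open>With \<open>X = (b\<^sub>V + \<delta>)(I + \<delta>\<^sup>*b\<^sub>V)\<^sup>-\<^sup>1D\<^sub>\<delta>\<close>, the operator \<open>B = D\<^sub>\<delta>\<^sub>*\<^sup>-\<^sup>1X\<close> is the bounded operator whose
  adjoint is the continuous extension of \<open>X\<^sup>*D\<^sub>\<delta>\<^sub>*\<^sup>-\<^sup>1\<close>, which is defined on the dense subspace
  \<open>Ran(D\<^sub>\<delta>\<^sub>*)\<close>.\<close>

definition char_fun ::
  "('h::complex_hilbert_space ^ 'd::finite \<Rightarrow> 'h) \<Rightarrow>
   (complex ^ 'd \<Rightarrow> 'j::complex_hilbert_space \<Rightarrow> 'h) \<Rightarrow>
   ('i::complex_hilbert_space \<Rightarrow> 'h ^ 'd) \<Rightarrow> complex ^ 'd \<Rightarrow> 'i \<Rightarrow> 'j"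
  where "char_fun T \<gamma> \<gamma>i z =
   (let \<delta> = delta T \<gamma> \<gamma>i; b = char_fun_V \<gamma> \<gamma>i z;
        X = (\<lambda>g. b g + \<delta> g) \<circ> inv (\<lambda>g. g + adj \<delta> (b g)) \<circ> defect \<delta>
    in THE B. B \<in> bounded_ops UNIV UNIV \<and>
         (\<forall>y\<in>range (defect_star \<delta>). adj B y = adj X (inv (defect_star \<delta>) y)))"

definition sz_nagy_foias ::
  "('h::complex_hilbert_space ^ 'd::finite \<Rightarrow> 'h) \<Rightarrow> complex ^ 'd \<Rightarrow> 'h ^ 'd \<Rightarrow> 'h"
  where "sz_nagy_foias T z =
    (\<lambda>x. - T x + defect_star T (inv (\<lambda>h. h - row z (adj T h)) (row z (defect T x))))"

end

theory Submission
  imports Defs "HOL-Library.Function_Algebras"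
begin

text \<open>Put \<open>B(z) = \<gamma>(0)\<^sup>*\<Theta>\<^sub>T(z)\<gamma>(\<infinity>)\<close>; weak coincidence with \<open>U = \<gamma>(0)\<close> is immediate once
  \<open>b\<^sub>T = B\<close>, because \<open>\<gamma>(0)\<close> and \<open>\<gamma>(\<infinity>)\<close> are isometries onto the two defect spaces. Let \<open>Q\<close> be the
  projection onto the closure of the range of \<open>D\<^sub>T\<^sub>*\<close>. Since \<open>V\<^sup>* = T\<^sup>*(I - Q)\<close> and \<open>\<gamma>(z)\<^sup>*\<close> annihilates
  the range of \<open>V - z\<close>, one has \<open>b\<^sub>V(z) = \<gamma>(0)\<^sup>*(I - zV\<^sup>*)\<^sup>-\<^sup>1z\<gamma>(\<infinity>)\<close>. The resolvent identity for
  \<open>zT\<^sup>*\<close> and \<open>zV\<^sup>*\<close> then inverts \<open>I + \<delta>\<^sup>*b\<^sub>V(z)\<close> and yields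
  \<open>(b\<^sub>V(z) + \<delta>)(I + \<delta>\<^sup>*b\<^sub>V(z))\<^sup>-\<^sup>1D\<^sub>\<delta> = D\<^sub>\<delta>\<^sub>*B(z)\<close>, which determines \<open>b\<^sub>T(z) = B(z)\<close> because \<open>D\<^sub>\<delta>\<^sub>*\<close> is
  injective. Contractivity of the multipliers comes from
  \<open>I - \<Theta>\<^sub>T(z)\<Theta>\<^sub>T(w)\<^sup>* = (1 - \<langle>z, w\<rangle>) D\<^sub>T\<^sub>*(I - zT\<^sup>*)\<^sup>-\<^sup>1(I - Tw\<^sup>*)\<^sup>-\<^sup>1D\<^sub>T\<^sub>*\<close>.\<close>

section \<open>Riesz representation\<close>

text \<open>A nonnegative quadratic polynomial in \<open>r\<close> has nonpositive discriminant.
  Cauchy-Schwarz estimates for semi-inner products, exact or with an error term in \<open>e\<close>,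
  all go through this form.\<close>

lemma quadratic_discriminant:
  fixes a e q :: real
  assumes "0 \<le> q" "\<And>r. 0 \<le> e + 2 * r * a + r\<^sup>2 * q"
  shows "a\<^sup>2 \<le> e * q"
proof (cases "q = 0")
  case True
  have e: "0 \<le> e"
    using assms(2)[of 0] by simp
  have "a = 0"
  proof (rule ccontr)
    assume "a \<noteq> 0"
    \<comment> \<open>For \<open>q = 0\<close> the polynomial is affine, and this value of
      \<open>r\<close> makes it equal to -1.\<close>
    then have "2 * (- (e + 1) / (2 * a)) * a = - (e + 1)"
      by (simp add: field_simps)
    then show False
      using assms(2)[of "- (e + 1) / (2 * a)"] True by simp
  qed
  then show ?thesis
    using True by simp
next
  case False
  with assms(1) have "0 < q"
    by simp
  then show ?thesis
    using assms(2)[of "- a / q"] by (simp add: field_simps power2_eq_square)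
qed

text \<open>The functional is given by its graph \<open>S\<close>, a linear relation, so that it can be specified by
  its values on generators without a check that it is well defined. The vector \<open>g\<close> is the minimiser
  of \<open>ip h h - 2 * t\<close> over \<open>(h, t) \<in> S\<close>.\<close>

lemma riesz_relation:
  fixes G :: "'v::ab_group_add set" and sc :: "real \<Rightarrow> 'v \<Rightarrow> 'v" and ip :: "'v \<Rightarrow> 'v \<Rightarrow> real"
  assumes G_add: "\<And>x y. x \<in> G \<Longrightarrow> y \<in> G \<Longrightarrow> x + y \<in> G"
    and G_sc: "\<And>r x. x \<in> G \<Longrightarrow> sc r x \<in> G"
    and sc_minus: "\<And>x. sc (- 1) x = - x"
    and ip_add: "\<And>x y w. x \<in> G \<Longrightarrow> y \<in> G \<Longrightarrow> w \<in> G \<Longrightarrow> ip (x + y) w = ip x w + ip y w"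
    and ip_sc: "\<And>r x w. x \<in> G \<Longrightarrow> w \<in> G \<Longrightarrow> ip (sc r x) w = r * ip x w"
    and ip_sym: "\<And>x w. x \<in> G \<Longrightarrow> w \<in> G \<Longrightarrow> ip x w = ip w x"
    and ip_pos: "\<And>x. x \<in> G \<Longrightarrow> 0 \<le> ip x x"
    and complete: "\<And>u. (\<And>n::nat. u n \<in> G) \<Longrightarrow>
      (\<And>e. e > 0 \<Longrightarrow> \<exists>N. \<forall>m\<ge>N. \<forall>n\<ge>N. ip (u m - u n) (u m - u n) < e) \<Longrightarrow>
      \<exists>f\<in>G. (\<lambda>n. ip (u n - f) (u n - f)) \<longlonglongrightarrow> 0"
    and S_G: "\<And>h t. (h, t) \<in> S \<Longrightarrow> h \<in> G"
    and S_ne: "S \<noteq> {}"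
    and S_add: "\<And>h t h' t'. (h, t) \<in> S \<Longrightarrow> (h', t') \<in> S \<Longrightarrow> (h + h', t + t') \<in> S"
    and S_sc: "\<And>r h t. (h, t) \<in> S \<Longrightarrow> (sc r h, r * t) \<in> S"
    and S_bd: "\<And>h t. (h, t) \<in> S \<Longrightarrow> t\<^sup>2 \<le> C * ip h h" and C: "0 \<le> C"
  obtains g where "g \<in> G" "\<And>h t. (h, t) \<in> S \<Longrightarrow> ip g h = t" "ip g g \<le> C"
proof -
  have G_diff: "x - y \<in> G" if "x \<in> G" "y \<in> G" for x y
    using G_add[OF that(1) G_sc[OF that(2), of "- 1"]] by (simp add: sc_minus)
  have ip_diff: "ip (x - y) w = ip x w - ip y w" if "x \<in> G" "y \<in> G" "w \<in> G" for x y w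
    using ip_add[OF that(1) G_sc[OF that(2), of "- 1"] that(3)] ip_sc[OF that(2,3), of "- 1"]
    by (simp add: sc_minus)
  have ip_add': "ip w (x + y) = ip w x + ip w y" if "x \<in> G" "y \<in> G" "w \<in> G" for x y w
    using that by (simp add: ip_sym[of w] G_add ip_add)
  have ip_sc': "ip w (sc r x) = r * ip w x" if "x \<in> G" "w \<in> G" for r x w
    using that by (simp add: ip_sym[of w] G_sc ip_sc)
  have ip_diff': "ip w (x - y) = ip w x - ip w y" if "x \<in> G" "y \<in> G" "w \<in> G" for x y w
    using that by (simp add: ip_sym[of w] G_diff ip_diff)
  note ips = ip_add ip_add' ip_sc ip_sc' ip_diff ip_diff' G_add G_sc G_diff
  define J where "J = (\<lambda>(h, t). ip h h - 2 * t)"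
  have J_ge: "- C \<le> J p" if "p \<in> S" for p
  proof -
    obtain h t where p: "p = (h, t)"
      by force
    have q: "0 \<le> ip h h" and t: "t\<^sup>2 \<le> C * ip h h"
      using that p S_G ip_pos S_bd by auto
    have "4 * (C * ip h h) \<le> (C + ip h h)\<^sup>2"
      using zero_le_power2[of "C - ip h h"] by (simp add: power2_eq_square algebra_simps)
    with t have "(2 * t)\<^sup>2 \<le> (C + ip h h)\<^sup>2"
      by (simp add: power_mult_distrib)
    then have "2 * t \<le> C + ip h h"
      by (rule power2_le_imp_le) (simp add: q C)
    then show ?thesis
      by (simp add: J_def p)
  qed
  define m where "m = Inf (J ` S)"
  have bdd: "bdd_below (J ` S)"
    using J_ge by (intro bdd_belowI2)
  have m_le: "m \<le> J p" if "p \<in> S" for p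
    unfolding m_def using bdd that by (intro cInf_lower) auto
  have "\<exists>p\<in>S. J p < m + 1 / real (Suc n)" for n
  proof -
    have "Inf (J ` S) < m + 1 / real (Suc n)"
      by (simp add: m_def)
    then show ?thesis
      using S_ne bdd by (subst (asm) cInf_less_iff) auto
  qed
  then obtain p where pS: "\<And>n. p n \<in> S" and pJ: "\<And>n. J (p n) < m + 1 / real (Suc n)"
    by metis
  define u where "u n = fst (p n)" for n
  define s where "s n = snd (p n)" for n
  have us: "(u n, s n) \<in> S" for n
    using pS[of n] by (simp add: u_def s_def)
  have uG: "u n \<in> G" for n
    using us S_G by blast
  have Ju: "ip (u n) (u n) - 2 * s n < m + 1 / real (Suc n)" for n
    using pJ[of n] by (simp add: J_def u_def s_def split_beta)
  have close: "ip (u k - u n) (u k - u n) \<le> 2 * (1 / real (Suc k) + 1 / real (Suc n))" for k n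
  proof -
    \<comment> \<open>The midpoint of two almost minimisers belongs to \<open>S\<close>, so
      \<open>J\<close> is at least \<open>m\<close> there; the parallelogram law then forces the two
      points to be close.\<close>
    have "(sc (1 / 2) (u k + u n), 1 / 2 * (s k + s n)) \<in> S"
      using us by (intro S_sc S_add)
    then have "m \<le> J (sc (1 / 2) (u k + u n), 1 / 2 * (s k + s n))"
      by (rule m_le)
    also have "\<dots> = 1 / 4 * ip (u k + u n) (u k + u n) - (s k + s n)"
      using uG by (simp add: J_def ips field_simps)
    finally have "m \<le> 1 / 4 * ip (u k + u n) (u k + u n) - (s k + s n)" .
    moreover have "ip (u k + u n) (u k + u n) + ip (u k - u n) (u k - u n)
        = 2 * ip (u k) (u k) + 2 * ip (u n) (u n)"
      using uG by (simp add: ips)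
    moreover have "d \<le> 2 * (a + b)"
      if "m \<le> 1 / 4 * p - (t + t')" "p + d = 2 * q + 2 * q'" "q - 2 * t < m + a" "q' - 2 * t' < m + b"
      for a b d p q q' t t' :: real
      using that by argo
    ultimately show ?thesis
      using Ju[of k] Ju[of n] by blast
  qed
  have "\<exists>N. \<forall>k\<ge>N. \<forall>n\<ge>N. ip (u k - u n) (u k - u n) < e" if "e > 0" for e
  proof -
    obtain N :: nat where N: "1 / real (Suc N) < e / 4"
      using \<open>e > 0\<close> nat_approx_posE[of "e / 4"] by auto
    have inv: "1 / real (Suc k) \<le> 1 / real (Suc N)" if "k \<ge> N" for k
      using that by (simp add: frac_le)
    have "ip (u k - u n) (u k - u n) < e" if "k \<ge> N" "n \<ge> N" for k n
      using close[of k n] inv[OF that(1)] inv[OF that(2)] N by argo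
    then show ?thesis
      by blast
  qed
  then obtain g where g: "g \<in> G" and lim: "(\<lambda>n. ip (u n - g) (u n - g)) \<longlonglongrightarrow> 0"
    using complete[of u] uG by blast
  have inv0: "(\<lambda>n. 1 / real (Suc n)) \<longlonglongrightarrow> 0"
    by (rule LIMSEQ_Suc[OF lim_1_over_n])
  have rep: "ip g h = t" if ht: "(h, t) \<in> S" for h t
  proof -
    have h: "h \<in> G"
      using ht S_G by blast
    \<comment> \<open>Moving the almost minimiser by a multiple of \<open>(h, t)\<close> cannot
      bring \<open>J\<close> below \<open>m\<close>, so the resulting quadratic in \<open>r\<close>
      is nonnegative up to the error \<open>1 / Suc n\<close>.\<close>
    have 1: "(ip (u n) h - t)\<^sup>2 \<le> 1 / real (Suc n) * ip h h" for n
    proof (rule quadratic_discriminant[OF ip_pos[OF h]])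
      fix r
      have "(u n + sc r h, s n + r * t) \<in> S"
        using us ht by (intro S_sc S_add)
      then have "m \<le> J (u n + sc r h, s n + r * t)"
        by (rule m_le)
      also have "\<dots> = ip (u n) (u n) - 2 * s n + 2 * r * (ip (u n) h - t) + r\<^sup>2 * ip h h"
        using uG h by (simp add: J_def ips ip_sym[of h "u n"] algebra_simps power2_eq_square)
      finally show "0 \<le> 1 / real (Suc n) + 2 * r * (ip (u n) h - t) + r\<^sup>2 * ip h h"
        using Ju[of n] by linarith
    qed
    \<comment> \<open>Cauchy-Schwarz, needed to replace \<open>u n\<close> by its limit
      \<open>g\<close>.\<close>
    have 2: "(ip (u n - g) h)\<^sup>2 \<le> ip (u n - g) (u n - g) * ip h h" for n
    proof (rule quadratic_discriminant[OF ip_pos[OF h]])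
      fix r
      obtain v where v: "v = u n - g" "v \<in> G"
        using G_diff[OF uG g] by blast
      have "0 \<le> ip (v + sc r h) (v + sc r h)"
        by (intro ip_pos G_add G_sc v(2) h)
      also have "\<dots> = ip v v + 2 * r * ip v h + r\<^sup>2 * ip h h"
        using v(2) h by (simp add: ip_add ip_add' ip_sc ip_sc' G_add G_sc ip_sym[of h v]
            algebra_simps power2_eq_square)
      finally show "0 \<le> ip (u n - g) (u n - g) + 2 * r * ip (u n - g) h + r\<^sup>2 * ip h h"
        by (simp only: v(1))
    qed
    have "(\<lambda>n. (ip (u n) h - t)\<^sup>2) \<longlonglongrightarrow> 0"
      by (rule Lim_null_comparison[OF _ tendsto_mult_left_zero[OF inv0, of "ip h h"]]) (use 1 in auto)
    then have 3: "(\<lambda>n. ip (u n) h - t) \<longlonglongrightarrow> 0"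
      by simp
    have "(\<lambda>n. (ip (u n - g) h)\<^sup>2) \<longlonglongrightarrow> 0"
      by (rule Lim_null_comparison[OF _ tendsto_mult_left_zero[OF lim, of "ip h h"]]) (use 2 in auto)
    then have "(\<lambda>n. ip (u n - g) h) \<longlonglongrightarrow> 0"
      by simp
    from tendsto_diff[OF 3 this] have "(\<lambda>n::nat. ip g h - t) \<longlonglongrightarrow> 0"
      using uG g h by (simp add: ip_diff)
    then show ?thesis
      by (simp add: LIMSEQ_const_iff)
  qed
  have "ip g g \<le> C"
  proof (rule LIMSEQ_le_const)
    have "(\<lambda>n. ip (u n - g) (u n - g) + C) \<longlonglongrightarrow> 0 + C"
      by (intro tendsto_add lim tendsto_const)
    then show "(\<lambda>n. ip (u n - g) (u n - g) + C) \<longlonglongrightarrow> C"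
      by simp
    \<comment> \<open>Since \<open>ip g (u n) = s n\<close>, completing the square writes
      \<open>J (u n, s n)\<close> as the squared distance of \<open>u n\<close> and \<open>g\<close>
      minus \<open>ip g g\<close>; its lower bound \<open>- C\<close> then bounds
      \<open>ip g g\<close> in the limit.\<close>
    have "ip (u n - g) (u n - g) = ip (u n) (u n) - 2 * s n + ip g g" for n
      using uG g rep[OF us[of n]] by (simp add: ips ip_sym[of "u n" g])
    moreover have "- C \<le> ip (u n) (u n) - 2 * s n" for n
      using J_ge[OF us[of n]] by (simp add: J_def)
    ultimately have "ip g g \<le> ip (u n - g) (u n - g) + C" for n
      by (smt (verit))
    then show "\<exists>N. \<forall>n\<ge>N. ip g g \<le> ip (u n - g) (u n - g) + C"
      by blast
  qed
  then show thesis
    using that g rep by blast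
qed

section \<open>Bounded operators and adjoints\<close>

text \<open>Gives completeness of the space of bounded linear maps, in which the square root
  iteration converges.\<close>

instance complex_hilbert_space \<subseteq> banach ..

lemma cinner_scaleC_right: "cinner x (a *\<^sub>C y) = cnj a * cinner x y"
  by (metis cinner_commute cinner_scaleC_left complex_cnj_mult)

lemma cinner_add_right: "cinner x (y + z) = cinner x y + cinner x z"
  by (metis cinner_add_left cinner_commute complex_cnj_add)

lemma cinner_zero_left [simp]: "cinner 0 x = 0"
  using cinner_add_left[of 0 0 x] by simp

lemma cinner_zero_right [simp]: "cinner x 0 = 0"
  using cinner_add_right[of x 0 0] by simp

lemma cinner_minus_left: "cinner (- x) y = - cinner x y"
  using cinner_add_left[of x "- x" y] by (simp add: minus_unique)

lemma cinner_minus_right: "cinner x (- y) = - cinner x y"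
  using cinner_add_right[of x y "- y"] by (simp add: minus_unique)

lemma cinner_diff_left: "cinner (x - y) z = cinner x z - cinner y z"
  using cinner_add_left[of x "- y" z] by (simp add: cinner_minus_left)

lemma cinner_diff_right: "cinner x (y - z) = cinner x y - cinner x z"
  using cinner_add_right[of x y "- z"] by (simp add: cinner_minus_right)

lemmas cinner_simps = cinner_add_left cinner_add_right cinner_diff_left cinner_diff_right
  cinner_minus_left cinner_minus_right cinner_scaleC_left cinner_scaleC_right

lemma scaleC_minus_right: "a *\<^sub>C (- x) = - (a *\<^sub>C x)" for x :: "'a::complex_hilbert_space"
  by (rule complex_vector.scale_minus_right)

lemma cinner_self: "cinner x x = complex_of_real ((norm x)\<^sup>2)"
proof (rule complex_eqI)
  show "Im (cinner x x) = Im (complex_of_real ((norm x)\<^sup>2))"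
    using cinner_commute[of x x] by (metis Im_complex_of_real Reals_cnj_iff complex_is_Real_iff)
qed (simp add: Re_cinner dot_square_norm)

lemma norm_scaleC: "norm (a *\<^sub>C x) = cmod a * norm x"
proof (rule power2_eq_imp_eq)
  have "complex_of_real ((norm (a *\<^sub>C x))\<^sup>2) = a * cnj a * cinner x x"
    by (simp add: cinner_self[symmetric] cinner_simps del: of_real_power)
  also have "\<dots> = complex_of_real ((cmod a * norm x)\<^sup>2)"
    by (simp add: cinner_self power_mult_distrib complex_norm_square[symmetric] flip: of_real_power)
  finally have "complex_of_real ((norm (a *\<^sub>C x))\<^sup>2) = complex_of_real ((cmod a * norm x)\<^sup>2)" .
  then show "(norm (a *\<^sub>C x))\<^sup>2 = (cmod a * norm x)\<^sup>2"
    by (simp only: of_real_eq_iff)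
qed auto

lemma Im_cinner: "Im (cinner x y) = inner x (\<i> *\<^sub>C y)"
  by (simp add: Re_cinner[symmetric] cinner_simps)

lemma eq_if_cinner_eq:
  assumes "complex_vector.subspace X" "x \<in> X" "y \<in> X" "\<And>u. u \<in> X \<Longrightarrow> cinner u x = cinner u y"
  shows "x = y"
proof -
  have "x - y \<in> X"
    using assms by (simp add: complex_vector.subspace_diff)
  then have "cinner (x - y) (x - y) = 0"
    using assms(4)[of "x - y"] by (simp add: cinner_diff_right)
  then show ?thesis
    by (simp add: cinner_self)
qed

lemma bounded_ops_bound:
  assumes "A \<in> bounded_ops X Y"
  obtains K where "K \<ge> 0" "\<And>x. x \<in> X \<Longrightarrow> norm (A x) \<le> K * norm x"
proof -
  obtain K where K: "\<And>x. x \<in> X \<Longrightarrow> norm (A x) \<le> K * norm x"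
    using assms unfolding bounded_ops_def by blast
  have "norm (A x) \<le> \<bar>K\<bar> * norm x" if "x \<in> X" for x
    by (rule order_trans[OF K[OF that]]) (simp add: mult_right_mono)
  then show thesis
    using that[of "\<bar>K\<bar>"] by simp
qed

lemma
  assumes "A \<in> bounded_ops X Y"
  shows bounded_ops_add: "x \<in> X \<Longrightarrow> y \<in> X \<Longrightarrow> A (x + y) = A x + A y"
    and bounded_ops_scaleC: "x \<in> X \<Longrightarrow> A (c *\<^sub>C x) = c *\<^sub>C A x"
    and bounded_ops_mem: "x \<in> X \<Longrightarrow> A x \<in> Y"
  using assms by (auto simp: bounded_ops_def)

section \<open>Bounded operators on the whole space\<close>

abbreviation bop :: "('a::complex_hilbert_space \<Rightarrow> 'b::complex_hilbert_space) \<Rightarrow> bool"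
  where "bop A \<equiv> A \<in> bounded_ops UNIV UNIV"

lemma bopI:
  assumes "\<And>x y. A (x + y) = A x + A y" "\<And>c x. A (c *\<^sub>C x) = c *\<^sub>C A x"
    "\<And>x. norm (A x) \<le> K * norm x"
  shows "bop A"
  using assms by (auto simp: bounded_ops_def)

lemma
  assumes "bop A"
  shows bop_add: "A (x + y) = A x + A y"
    and bop_scaleC: "A (c *\<^sub>C x) = c *\<^sub>C A x"
  using assms by (auto simp: bounded_ops_def)

lemma bop_linear: "bop A \<Longrightarrow> linear A"
  by (intro linearI) (simp_all add: bop_add bop_scaleC scaleC_of_real[symmetric])

lemma
  assumes "bop A"
  shows bop_zero: "A 0 = 0"
    and bop_minus: "A (- x) = - A x"
    and bop_diff: "A (x - y) = A x - A y"
  using bop_linear[OF assms] by (simp_all add: linear_0 linear_neg linear_diff)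

lemma bop_bounded_linear: "bop A \<Longrightarrow> bounded_linear A"
  by (metis bop_linear bounded_linear.intro bounded_linear_axioms.intro bounded_ops_bound UNIV_I
      mult.commute)

lemmas bop_simps = bop_add bop_scaleC bop_zero bop_minus bop_diff

lemma bop_comp:
  assumes "bop A" "bop B"
  shows "bop (\<lambda>x. A (B x))"
proof -
  obtain K L where K: "K \<ge> 0" "\<And>x. norm (A x) \<le> K * norm x" and L: "\<And>x. norm (B x) \<le> L * norm x"
    using assms by (metis bounded_ops_bound UNIV_I)
  show ?thesis
  proof (rule bopI)
    fix x
    show "norm (A (B x)) \<le> (K * L) * norm x"
      using K(1) K(2)[of "B x"] mult_left_mono[OF L[of x] K(1)] by (simp add: mult.assoc)
  qed (use assms in \<open>simp_all add: bop_simps\<close>)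
qed

lemma bop_sum:
  assumes "bop A" "bop B"
  shows "bop (\<lambda>x. A x + B x)"
proof -
  obtain K L where "\<And>x. norm (A x) \<le> K * norm x" "\<And>x. norm (B x) \<le> L * norm x"
    using assms by (metis bounded_ops_bound UNIV_I)
  then have "norm (A x + B x) \<le> (K + L) * norm x" for x
    by (metis norm_triangle_mono distrib_right)
  then show ?thesis
    by (intro bopI[where K = "K + L"]) (use assms in \<open>simp_all add: bop_simps scaleC_add_right\<close>)
qed

lemma bop_uminus: "bop A \<Longrightarrow> bop (\<lambda>x. - A x)"
  by (auto simp: bounded_ops_def scaleC_minus_right)

lemma bop_subtract: "bop A \<Longrightarrow> bop B \<Longrightarrow> bop (\<lambda>x. A x - B x)"
  using bop_sum[OF _ bop_uminus] by force

lemma bop_id: "bop (\<lambda>x. x)"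
  by (rule bopI[where K = 1]) auto

lemma bounded_ops_mono_range: "A \<in> bounded_ops X Y \<Longrightarrow> Y \<subseteq> Y' \<Longrightarrow> A \<in> bounded_ops X Y'"
  by (auto simp: bounded_ops_def)

section \<open>Existence and algebra of adjoints\<close>

lemma adj_on_eqI:
  assumes "complex_vector.subspace X" "x \<in> X" "\<And>u. u \<in> X \<Longrightarrow> cinner (A u) y = cinner u x"
  shows "adj_on X A y = x"
  unfolding adj_on_def
proof (rule the_equality)
  fix x'
  assume "x' \<in> X \<and> (\<forall>u\<in>X. cinner (A u) y = cinner u x')"
  then show "x' = x"
    using assms by (intro eq_if_cinner_eq[OF assms(1)]) auto
qed (use assms in auto)

text \<open>Riesz representation of the real functional that sends \<open>u\<close> to the real part
  of \<open>cinner (A u) y\<close>; closedness of \<open>X\<close> supplies the completeness. The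
  imaginary part of the identity is the real part at \<open>\<i> *\<^sub>C u\<close>.\<close>

lemma adj_on:
  assumes X: "complex_vector.subspace X" "closed X" and A: "A \<in> bounded_ops X Y"
  shows adj_on_mem: "adj_on X A y \<in> X"
    and cinner_adj_on: "u \<in> X \<Longrightarrow> cinner (A u) y = cinner u (adj_on X A y)"
proof -
  have scR: "r *\<^sub>R x \<in> X" if "x \<in> X" for r x
    using complex_vector.subspace_scale[OF X(1) that, of "complex_of_real r"]
    by (simp add: scaleC_of_real)
  have A_scR: "A (r *\<^sub>R x) = r *\<^sub>R A x" if "x \<in> X" for r x
    using bounded_ops_scaleC[OF A that, of "complex_of_real r"] by (simp add: scaleC_of_real)
  obtain K where K: "K \<ge> 0" "\<And>x. x \<in> X \<Longrightarrow> norm (A x) \<le> K * norm x"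
    using bounded_ops_bound[OF A] by blast
  define S where "S = (\<lambda>u. (u, inner (A u) y)) ` X"
  obtain g where g: "g \<in> X" "\<And>h t. (h, t) \<in> S \<Longrightarrow> inner g h = t"
  proof (rule riesz_relation[of X scaleR inner S "(K * norm y)\<^sup>2"])
    fix u :: "nat \<Rightarrow> 'a"
    assume u: "\<And>n. u n \<in> X"
      and cau: "\<And>e. e > 0 \<Longrightarrow> \<exists>N. \<forall>m\<ge>N. \<forall>n\<ge>N. inner (u m - u n) (u m - u n) < e"
    have "Cauchy u"
    proof (rule metric_CauchyI)
      fix e :: real
      assume "e > 0"
      then obtain N where N: "\<forall>m\<ge>N. \<forall>n\<ge>N. inner (u m - u n) (u m - u n) < e\<^sup>2"
        using cau[of "e\<^sup>2"] by auto
      have "dist (u m) (u n) < e" if "m \<ge> N" "n \<ge> N" for m n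
        using N that \<open>e > 0\<close>
        by (intro power_less_imp_less_base[of "dist (u m) (u n)" 2 e]) (auto simp: dist_norm dot_square_norm)
      then show "\<exists>M. \<forall>m\<ge>M. \<forall>n\<ge>M. dist (u m) (u n) < e"
        by blast
    qed
    then obtain f where f: "u \<longlonglongrightarrow> f"
      using Cauchy_convergent_iff convergent_def by blast
    have "f \<in> X"
      using X(2) f u closed_sequentially by blast
    moreover have "(\<lambda>n. inner (u n - f) (u n - f)) \<longlonglongrightarrow> inner (f - f) (f - f)"
      by (intro tendsto_inner tendsto_diff f tendsto_const)
    ultimately show "\<exists>f\<in>X. (\<lambda>n. inner (u n - f) (u n - f)) \<longlonglongrightarrow> 0"
      by auto
  next
    fix h t
    assume "(h, t) \<in> S"
    then have "t = inner (A h) y" and h: "h \<in> X"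
      by (auto simp: S_def)
    have "\<bar>t\<bar> \<le> norm (A h) * norm y"
      using \<open>t = _\<close> Cauchy_Schwarz_ineq2 by blast
    also have "\<dots> \<le> K * norm h * norm y"
      using K(2)[OF h] by (rule mult_right_mono) simp
    finally have "\<bar>t\<bar>\<^sup>2 \<le> (K * norm h * norm y)\<^sup>2"
      by (rule power_mono) simp
    then show "t\<^sup>2 \<le> (K * norm y)\<^sup>2 * inner h h"
      by (simp add: power_mult_distrib dot_square_norm mult_ac)
  next
    fix h t h' t'
    assume "(h, t) \<in> S" "(h', t') \<in> S"
    then show "(h + h', t + t') \<in> S"
      using complex_vector.subspace_add[OF X(1)] bounded_ops_add[OF A]
      by (auto simp: S_def image_iff inner_add_left)
  next
    fix r h t
    assume "(h, t) \<in> S"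
    then show "(r *\<^sub>R h, r * t) \<in> S"
      using scR A_scR by (auto simp: S_def image_iff)
  next
    show "inner x w = inner w x" for x w :: 'a
      by (rule inner_commute)
  next
    show "S \<noteq> {}"
      using complex_vector.subspace_0[OF X(1)] by (auto simp: S_def)
  qed (use scR X(1) in \<open>auto simp: S_def complex_vector.subspace_add inner_add_left\<close>)
  have *: "inner (A u) y = inner u g" if "u \<in> X" for u
    using g(2)[of u "inner (A u) y"] that by (auto simp: S_def inner_commute)
  have iX: "\<i> *\<^sub>C u \<in> X" if "u \<in> X" for u
    using that X(1) by (simp add: complex_vector.subspace_scale)
  have main: "cinner (A u) y = cinner u g" if "u \<in> X" for u
  proof (rule complex_eqI)
    have "Re (cinner (A (\<i> *\<^sub>C u)) y) = Re (cinner (\<i> *\<^sub>C u) g)"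
      using *[OF iX[OF that]] by (simp add: Re_cinner)
    then show "Im (cinner (A u) y) = Im (cinner u g)"
      using that by (simp add: bounded_ops_scaleC[OF A] cinner_simps)
  qed (simp add: Re_cinner *[OF that])
  have "adj_on X A y = g"
    using main g(1) by (intro adj_on_eqI X(1))
  then show "adj_on X A y \<in> X" "u \<in> X \<Longrightarrow> cinner (A u) y = cinner u (adj_on X A y)"
    using g(1) main by auto
qed

lemma adj_eqI: "(\<And>u. cinner (A u) y = cinner u x) \<Longrightarrow> adj A y = x"
  by (rule adj_on_eqI) auto

lemma cinner_adj: "bop A \<Longrightarrow> cinner (A u) y = cinner u (adj A y)"
  by (rule cinner_adj_on) auto

lemma cinner_adj': "bop A \<Longrightarrow> cinner y (A u) = cinner (adj A y) u"
  by (metis cinner_adj cinner_commute)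

text \<open>The squared norm of \<open>adj A y\<close> is the inner product of
  \<open>A (adj A y)\<close> with \<open>y\<close>, so Cauchy-Schwarz gives the bound after division
  by \<open>norm (adj A y)\<close>.\<close>

lemma norm_adj_le:
  assumes "bop A" "\<And>x. norm (A x) \<le> K * norm x" "K \<ge> 0"
  shows "norm (adj A y) \<le> K * norm y"
proof (cases "adj A y = 0")
  case True
  then show ?thesis
    using assms(3) by simp
next
  case False
  have "(norm (adj A y))\<^sup>2 = Re (cinner (A (adj A y)) y)"
    by (simp add: cinner_adj[OF assms(1)] cinner_self)
  also have "\<dots> \<le> norm (A (adj A y)) * norm y"
    by (simp add: Re_cinner norm_cauchy_schwarz)
  also have "\<dots> \<le> K * norm (adj A y) * norm y"
    by (intro mult_right_mono assms(2)) simp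
  finally show ?thesis
    using False by (simp add: power2_eq_square)
qed

lemma bop_adj:
  assumes "bop A"
  shows "bop (adj A)"
proof -
  obtain K where K: "K \<ge> 0" "\<And>x. norm (A x) \<le> K * norm x"
    using bounded_ops_bound[OF assms] by auto
  show ?thesis
  proof (rule bopI)
    show "norm (adj A y) \<le> K * norm y" for y
      using assms K(2,1) by (rule norm_adj_le)
  qed (use assms in \<open>auto intro!: adj_eqI simp: cinner_adj cinner_simps\<close>)
qed

lemma adj_adj:
  assumes "bop A"
  shows "adj (adj A) = A"
  by (rule ext, rule adj_eqI) (metis assms cinner_adj')

lemma adj_comp:
  assumes "bop A" "bop B"
  shows "adj (\<lambda>x. A (B x)) y = adj B (adj A y)"
  by (rule adj_eqI) (simp add: assms cinner_adj)

section \<open>Orthogonal complements and projections\<close>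

lemma subspace_ortho: "complex_vector.subspace (ortho S)"
  by (auto simp: complex_vector.subspace_def ortho_def cinner_simps)

lemma closed_ortho: "closed (ortho S)"
proof -
  have "ortho S = (\<Inter>y\<in>S. {x. inner x y = 0} \<inter> {x. inner x (\<i> *\<^sub>C y) = 0})"
    by (auto simp: ortho_def complex_eq_iff Re_cinner Im_cinner)
  then show ?thesis
    by (auto intro!: closed_INT closed_Int closed_Collect_eq continuous_intros)
qed

lemma orthoD: "x \<in> ortho S \<Longrightarrow> y \<in> S \<Longrightarrow> cinner x y = 0"
  by (simp add: ortho_def)

lemma ortho_sym: "x \<in> ortho S \<Longrightarrow> y \<in> S \<Longrightarrow> cinner x y = 0 \<and> cinner y x = 0"
  by (metis (mono_tags) cinner_commute complex_cnj_zero mem_Collect_eq ortho_def)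

text \<open>For \<open>x\<close> orthogonal to \<open>S\<close>, the set \<open>ortho {x}\<close> is
  closed and contains \<open>S\<close>, hence contains its closure.\<close>

lemma ortho_closure: "ortho (closure S) = ortho S"
proof
  show "ortho S \<subseteq> ortho (closure S)"
  proof
    fix x
    assume x: "x \<in> ortho S"
    have "S \<subseteq> ortho {x}"
      using ortho_sym[OF x] by (auto simp: ortho_def)
    then have "closure S \<subseteq> ortho {x}"
      by (rule closure_minimal[OF _ closed_ortho])
    then have "cinner x y = 0" if "y \<in> closure S" for y
      using ortho_sym[of y "{x}" x] that by blast
    then show "x \<in> ortho (closure S)"
      by (simp add: ortho_def)
  qed
qed (use closure_subset[of S] in \<open>auto simp: ortho_def\<close>)

lemma proj_eqI:
  assumes "complex_vector.subspace M" "y \<in> M" "x - y \<in> ortho M"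
  shows "proj M x = y"
  unfolding proj_def
proof (rule the_equality)
  fix y'
  assume y': "y' \<in> M \<and> x - y' \<in> ortho M"
  show "y' = y"
  proof (rule eq_if_cinner_eq[OF assms(1)])
    fix u
    assume "u \<in> M"
    then have "cinner u (x - y) = 0" "cinner u (x - y') = 0"
      using ortho_sym y' assms(3) by blast+
    then show "cinner u y' = cinner u y"
      by (simp add: cinner_diff_right)
  qed (use y' assms(2) in auto)
qed (use assms in auto)

lemma
  assumes "complex_vector.subspace M" "closed M"
  shows proj_mem: "proj M x \<in> M"
    and proj_ortho: "x - proj M x \<in> ortho M"
proof -
  \<comment> \<open>The adjoint of the inclusion of \<open>M\<close> into the whole space is the
    orthogonal projection onto \<open>M\<close>.\<close>
  define y where "y = adj_on M (\<lambda>u. u) x"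
  have id: "(\<lambda>u. u) \<in> bounded_ops M UNIV"
    by (auto simp: bounded_ops_def intro: exI[of _ 1])
  have "y \<in> M"
    unfolding y_def by (rule adj_on_mem[OF assms id])
  moreover have "cinner (x - y) u = 0" if "u \<in> M" for u
  proof -
    have "cinner u (x - y) = 0"
      using cinner_adj_on[OF assms id that, of x] by (simp add: y_def cinner_diff_right)
    then show ?thesis
      by (metis cinner_commute complex_cnj_zero)
  qed
  then have "x - y \<in> ortho M"
    by (simp add: ortho_def)
  ultimately show "proj M x \<in> M" "x - proj M x \<in> ortho M"
    using proj_eqI[OF assms(1)] by auto
qed

text \<open>If \<open>x\<close> is in the double complement, then \<open>x - proj M x\<close> is
  orthogonal to \<open>x\<close> and to \<open>proj M x\<close>, hence to itself.\<close>

lemma ortho_ortho: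
  assumes "complex_vector.subspace M" "closed M"
  shows "ortho (ortho M) = M"
proof
  show "ortho (ortho M) \<subseteq> M"
  proof
    fix x
    assume x: "x \<in> ortho (ortho M)"
    let ?p = "proj M x"
    have p: "?p \<in> M" "x - ?p \<in> ortho M"
      using assms by (simp_all add: proj_mem proj_ortho)
    have "cinner x (x - ?p) = 0" "cinner ?p (x - ?p) = 0"
      using ortho_sym[OF x p(2)] ortho_sym[OF p(2) p(1)] by auto
    then have "cinner (x - ?p) (x - ?p) = 0"
      by (simp only: cinner_diff_left) simp
    then show "x \<in> M"
      using p(1) by (simp add: cinner_self)
  qed
  show "M \<subseteq> ortho (ortho M)"
  proof
    fix x
    assume "x \<in> M"
    then have "cinner x y = 0" if "y \<in> ortho M" for y
      using ortho_sym[OF that] by blast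
    then show "x \<in> ortho (ortho M)"
      by (simp add: ortho_def)
  qed
qed

lemma bounded_linear_scaleC: "bounded_linear (\<lambda>x::'a::complex_hilbert_space. c *\<^sub>C x)"
  by (rule bounded_linear_intro[where K = "cmod c"])
    (auto simp: scaleC_add_right norm_scaleC scaleC_of_real[symmetric] scaleC_scaleC mult.commute)

lemma subspace_closure:
  assumes "complex_vector.subspace S"
  shows "complex_vector.subspace (closure S)"
proof (rule complex_vector.subspaceI)
  show "0 \<in> closure S"
    using closure_subset complex_vector.subspace_0[OF assms] by blast
  show "x + y \<in> closure S" if "x \<in> closure S" "y \<in> closure S" for x y
  proof -
    obtain a b where "\<And>n. a n \<in> S" "a \<longlonglongrightarrow> x" "\<And>n. b n \<in> S" "b \<longlonglongrightarrow> y"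
      using \<open>x \<in> closure S\<close> \<open>y \<in> closure S\<close> unfolding closure_sequential by blast
    then have "\<forall>n. a n + b n \<in> S" "(\<lambda>n. a n + b n) \<longlonglongrightarrow> x + y"
      by (auto intro: tendsto_add complex_vector.subspace_add[OF assms])
    then show ?thesis
      unfolding closure_sequential by (intro exI[of _ "\<lambda>n. a n + b n"] conjI)
  qed
  show "c *\<^sub>C x \<in> closure S" if x: "x \<in> closure S" for c x
  proof -
    obtain a where a: "\<And>n. a n \<in> S" "a \<longlonglongrightarrow> x"
      using x unfolding closure_sequential by blast
    have "(\<lambda>n. c *\<^sub>C a n) \<longlonglongrightarrow> c *\<^sub>C x"
      using bounded_linear_scaleC a(2) by (rule bounded_linear.tendsto)
    moreover have "\<forall>n. c *\<^sub>C a n \<in> S"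
      using a(1) complex_vector.subspace_scale[OF assms] by blast
    ultimately show ?thesis
      unfolding closure_sequential by (intro exI[of _ "\<lambda>n. c *\<^sub>C a n"] conjI)
  qed
qed

lemma subspace_range:
  assumes "bop A"
  shows "complex_vector.subspace (range A)"
  by (rule complex_vector.subspaceI)
    (use bop_zero[OF assms] in \<open>auto simp: image_iff bop_add[OF assms, symmetric]
      bop_scaleC[OF assms, symmetric] intro: exI[of _ 0]\<close>)

lemma
  assumes "bop A"
  shows subspace_kernel: "complex_vector.subspace (kernel A)"
    and closed_kernel: "closed (kernel A)"
proof -
  show "complex_vector.subspace (kernel A)"
    by (rule complex_vector.subspaceI) (auto simp: kernel_def bop_simps[OF assms])
  show "closed (kernel A)"
    unfolding kernel_def
    by (intro closed_Collect_eq continuous_intros linear_continuous_on bop_bounded_linear assms)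
qed

text \<open>The orthogonal complement of the range is the kernel of the adjoint, here of
  \<open>A\<close> itself; a second complement gives the closure of the range.\<close>

lemma closure_range_selfadjoint:
  assumes "bop A" "adj A = A"
  shows "closure (range A) = ortho (kernel A)"
proof -
  have "ortho (range A) = kernel A"
  proof -
    have "(\<forall>y. cinner x (A y) = 0) \<longleftrightarrow> A x = 0" for x
      using cinner_adj'[OF assms(1), of x] assms(2) by (metis cinner_self cinner_zero_left of_real_eq_0_iff
          norm_eq_zero power_eq_0_iff)
    then show ?thesis
      by (auto simp: ortho_def kernel_def)
  qed
  then show ?thesis
    using ortho_ortho[of "closure (range A)"] subspace_closure[OF subspace_range[OF assms(1)]]
    by (simp add: ortho_closure)
qed

section \<open>Square roots and defect operators\<close>

text \<open>Self-adjointness comes from polarisation: the quadratic form is real at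
  \<open>x + y\<close> and at \<open>x + \<i> *\<^sub>C y\<close>, which relates the imaginary and
  the real parts of \<open>cinner (B x) y\<close> and \<open>cinner (B y) x\<close>.\<close>

lemma
  assumes "positive_op B"
  shows positive_op_bop: "bop B"
    and positive_op_adj: "adj B = B"
    and positive_op_ge: "0 \<le> inner (B x) x"
proof -
  show B: "bop B"
    using assms by (simp add: positive_op_def)
  have q: "Im (cinner (B x) x) = 0" "0 \<le> Re (cinner (B x) x)" for x
    using assms by (auto simp: positive_op_def complex_nonneg_Reals_iff)
  have "cinner (B x) y = cinner x (B y)" for x y
  proof -
    have "Im (cinner (B x) y) = - Im (cinner (B y) x)"
      using q(1)[of "x + y"] q(1)[of x] q(1)[of y] by (simp add: bop_simps[OF B] cinner_simps)
    moreover have "Re (cinner (B x) y) = Re (cinner (B y) x)"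
      using q(1)[of "x + \<i> *\<^sub>C y"] q(1)[of x] q(1)[of y]
      by (simp add: bop_simps[OF B] cinner_simps)
    ultimately show ?thesis
      using cinner_commute[of x "B y"] by (simp add: complex_eq_iff)
  qed
  then show "adj B = B"
    by (intro ext adj_eqI)
  show "0 \<le> inner (B x) x"
    using q(2)[of x] by (simp add: Re_cinner)
qed

text \<open>The form of \<open>B\<close> at \<open>y + r *\<^sub>R B y\<close> is a nonnegative
  quadratic in \<open>r\<close> with vanishing constant term, so its linear coefficient, twice the
  squared norm of \<open>B y\<close>, vanishes as well.\<close>

lemma positive_op_null:
  assumes "positive_op B" "inner (B y) y = 0"
  shows "B y = 0"
proof -
  have B: "bop B" "\<And>x y. inner (B x) y = inner x (B y)"
    using positive_op_bop[OF assms(1)] cinner_adj[of B] positive_op_adj[OF assms(1)]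
    by (auto simp: Re_cinner[symmetric])
  have "(inner (B y) (B y))\<^sup>2 \<le> 0 * inner (B (B y)) (B y)"
  proof (rule quadratic_discriminant[OF positive_op_ge[OF assms(1)]])
    fix r
    have "0 \<le> inner (B (y + r *\<^sub>R B y)) (y + r *\<^sub>R B y)"
      by (rule positive_op_ge[OF assms(1)])
    also have "\<dots> = 0 + 2 * r * inner (B y) (B y) + r\<^sup>2 * inner (B (B y)) (B y)"
      using assms(2) B(2)[of "B y" y]
      by (simp add: linear_add[OF bop_linear[OF B(1)]] linear_scale[OF bop_linear[OF B(1)]]
          inner_simps power2_eq_square algebra_simps)
    finally show "0 \<le> 0 + 2 * r * inner (B y) (B y) + r\<^sup>2 * inner (B (B y)) (B y)" .
  qed
  then show ?thesis
    by simp
qed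

text \<open>For y = (B - C) x, commutation gives (B + C) y = 0. Positivity then forces B y = C y =
  0, so that the squared norm of y, which is the inner product of x with (B - C) y, is zero.\<close>

lemma commuting_sqrt_unique:
  assumes B: "positive_op B" and C: "positive_op C"
    and comm: "\<And>x. B (C x) = C (B x)" and sq: "\<And>x. B (B x) = C (C x)"
  shows "B = C"
proof
  fix x
  define y where "y = B x - C x"
  note bB = positive_op_bop[OF B] and bC = positive_op_bop[OF C]
  have "B y + C y = 0"
    by (simp add: y_def bop_simps[OF bB] bop_simps[OF bC] comm sq)
  then have "inner (B y) y + inner (C y) y = 0"
    by (metis inner_add_left inner_zero_left)
  then have "B y = 0" "C y = 0"
    using positive_op_ge[OF B, of y] positive_op_ge[OF C, of y]
    by (auto intro!: positive_op_null[OF B] positive_op_null[OF C])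
  then have "cinner y y = cinner x (B y) - cinner x (C y)"
    using cinner_adj[OF bB, of x y] cinner_adj[OF bC, of x y]
    by (simp add: y_def cinner_diff_left positive_op_adj[OF B] positive_op_adj[OF C])
  then have "y = 0"
    using \<open>B y = 0\<close> \<open>C y = 0\<close> by (simp add: cinner_self)
  then show "B x = C x"
    by (simp add: y_def)
qed

section \<open>The square root of I - S by iteration\<close>

text \<open>If \<open>L\<close> is the limit of this iteration, then \<open>L = (S + L\<^sup>2) / 2\<close>, so that \<open>(I - L)\<^sup>2 = I - S\<close>.
  The iteration for \<open>S = 1\<close> in \<open>\<real>\<close> is a majorant.\<close>

primrec sqrt_iter :: "('a::real_normed_vector \<Rightarrow>\<^sub>L 'a) \<Rightarrow> nat \<Rightarrow> 'a \<Rightarrow>\<^sub>L 'a" where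
  "sqrt_iter S 0 = 0"
| "sqrt_iter S (Suc n) = (1 / 2) *\<^sub>R (S + (sqrt_iter S n o\<^sub>L sqrt_iter S n))"

primrec sqrt_majorant :: "nat \<Rightarrow> real" where
  "sqrt_majorant 0 = 0"
| "sqrt_majorant (Suc n) = (1 + (sqrt_majorant n)\<^sup>2) / 2"

lemma sqrt_majorant_bounds: "0 \<le> sqrt_majorant n \<and> sqrt_majorant n \<le> 1"
proof (induction n)
  case (Suc n)
  then have "(sqrt_majorant n)\<^sup>2 \<le> 1"
    by (simp add: power_le_one)
  then show ?case
    by simp
qed simp

text \<open>Consecutive terms a, a' satisfy a' - a = (1 - a)^2 / 2.\<close>

lemma sqrt_majorant_mono: "incseq sqrt_majorant"
proof (rule incseq_SucI)
  fix n
  show "sqrt_majorant n \<le> sqrt_majorant (Suc n)"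
    using zero_le_power2[of "1 - sqrt_majorant n"] by (simp add: power2_eq_square algebra_simps)
qed

lemma norm_sqrt_iter_le:
  assumes "norm S \<le> 1"
  shows "norm (sqrt_iter S n) \<le> sqrt_majorant n"
proof (induction n)
  case (Suc n)
  have "norm (S + (sqrt_iter S n o\<^sub>L sqrt_iter S n))
      \<le> norm S + norm (sqrt_iter S n) * norm (sqrt_iter S n)"
    by (intro order_trans[OF norm_triangle_ineq] add_left_mono norm_blinfun_compose)
  also have "\<dots> \<le> 1 + sqrt_majorant n * sqrt_majorant n"
    using Suc assms by (intro add_mono mult_mono) (auto simp: sqrt_majorant_bounds)
  finally show ?case
    by (simp add: power2_eq_square)
qed simp

text \<open>Without commutativity, Y'^2 - Y^2 = Y' (Y' - Y) + (Y' - Y) Y; estimating each factor by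
  its majorant reproduces the same identity for real numbers.\<close>

lemma norm_sqrt_iter_Suc_diff:
  assumes "norm S \<le> 1"
  shows "norm (sqrt_iter S (Suc n) - sqrt_iter S n) \<le> sqrt_majorant (Suc n) - sqrt_majorant n"
proof (induction n)
  case 0
  then show ?case
    using assms by simp
next
  case (Suc n)
  define Y Y' where "Y = sqrt_iter S n" and "Y' = sqrt_iter S (Suc n)"
  define y y' where "y = sqrt_majorant n" and "y' = sqrt_majorant (Suc n)"
  have YY: "norm Y \<le> y" "norm Y' \<le> y'" "norm (Y' - Y) \<le> y' - y" "0 \<le> y" "0 \<le> y'"
    using norm_sqrt_iter_le[OF assms] Suc sqrt_majorant_bounds[of n] sqrt_majorant_bounds[of "Suc n"]
    unfolding Y_def Y'_def y_def y'_def by blast+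
  have "sqrt_iter S (Suc (Suc n)) - sqrt_iter S (Suc n)
      = (1 / 2) *\<^sub>R (S + (Y' o\<^sub>L Y')) - (1 / 2) *\<^sub>R (S + (Y o\<^sub>L Y))"
    by (simp add: Y_def Y'_def)
  also have "\<dots> = (1 / 2) *\<^sub>R ((Y' o\<^sub>L (Y' - Y)) + ((Y' - Y) o\<^sub>L Y))"
    by (intro blinfun_eqI) (simp add: blinfun.bilinear_simps scaleR_diff_right scaleR_add_right)
  finally have "norm (sqrt_iter S (Suc (Suc n)) - sqrt_iter S (Suc n))
      = 1 / 2 * norm ((Y' o\<^sub>L (Y' - Y)) + ((Y' - Y) o\<^sub>L Y))"
    by simp
  also have "\<dots> \<le> 1 / 2 * (norm Y' * norm (Y' - Y) + norm (Y' - Y) * norm Y)"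
    by (intro mult_left_mono norm_triangle_mono norm_blinfun_compose) auto
  also have "\<dots> \<le> 1 / 2 * (y' * (y' - y) + (y' - y) * y)"
    using YY order_trans[OF norm_ge_zero YY(3)] by (intro mult_left_mono add_mono mult_mono) auto
  also have "\<dots> = sqrt_majorant (Suc (Suc n)) - sqrt_majorant (Suc n)"
    by (simp add: y_def y'_def power2_eq_square algebra_simps add_divide_distrib[symmetric]
        diff_divide_distrib[symmetric])
  finally show ?case .
qed

text \<open>By telescoping, distances between iterates are dominated by those of the majorant, a
  bounded increasing real sequence.\<close>

lemma convergent_sqrt_iter:
  fixes S :: "'a::banach \<Rightarrow>\<^sub>L 'a"
  assumes "norm S \<le> 1"
  shows "convergent (sqrt_iter S)"
proof -
  have diff: "norm (sqrt_iter S (n + k) - sqrt_iter S n) \<le> sqrt_majorant (n + k) - sqrt_majorant n"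
    for n k
  proof (induction k)
    case (Suc k)
    have "norm (sqrt_iter S (n + Suc k) - sqrt_iter S n)
        \<le> norm (sqrt_iter S (Suc (n + k)) - sqrt_iter S (n + k)) + norm (sqrt_iter S (n + k) - sqrt_iter S n)"
      using norm_triangle_ineq[of "sqrt_iter S (Suc (n + k)) - sqrt_iter S (n + k)"
          "sqrt_iter S (n + k) - sqrt_iter S n"] by (simp only: add_Suc_right) simp
    then show ?case
      using Suc norm_sqrt_iter_Suc_diff[OF assms, of "n + k"] by (simp only: add_Suc_right)
  qed simp
  have "Cauchy sqrt_majorant"
    using sqrt_majorant_bounds
    by (intro convergent_Cauchy Bseq_monoseq_convergent BseqI'[of _ 1] incseq_imp_monoseq
        sqrt_majorant_mono) auto
  have "Cauchy (sqrt_iter S)"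
  proof (rule metric_CauchyI)
    fix e :: real
    assume "e > 0"
    then obtain M where M: "\<And>m n. m \<ge> M \<Longrightarrow> n \<ge> M \<Longrightarrow> dist (sqrt_majorant m) (sqrt_majorant n) < e"
      using \<open>Cauchy sqrt_majorant\<close> metric_CauchyD by blast
    have *: "dist (sqrt_iter S m) (sqrt_iter S n) < e" if "m \<ge> n" "n \<ge> M" for m n
      using diff[of n "m - n"] M[of m n] that by (simp add: dist_norm)
    have "dist (sqrt_iter S m) (sqrt_iter S n) < e" if "m \<ge> M" "n \<ge> M" for m n
      using *[of m n] *[of n m] that by (cases "m \<ge> n") (auto simp: dist_commute)
    then show "\<exists>M. \<forall>m\<ge>M. \<forall>n\<ge>M. dist (sqrt_iter S m) (sqrt_iter S n) < e"
      by blast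
  qed
  then show ?thesis
    by (simp add: Cauchy_convergent_iff)
qed

definition sqrt_limit :: "('a::banach \<Rightarrow>\<^sub>L 'a) \<Rightarrow> 'a \<Rightarrow>\<^sub>L 'a"
  where "sqrt_limit S = lim (sqrt_iter S)"

lemma sqrt_iter_tendsto: "norm S \<le> 1 \<Longrightarrow> sqrt_iter S \<longlonglongrightarrow> sqrt_limit S"
  unfolding sqrt_limit_def using convergent_sqrt_iter convergent_LIMSEQ_iff by blast

lemma sqrt_iter_apply_tendsto:
  "norm S \<le> 1 \<Longrightarrow> (\<lambda>n. blinfun_apply (sqrt_iter S n) x) \<longlonglongrightarrow> blinfun_apply (sqrt_limit S) x"
  by (intro tendsto_intros sqrt_iter_tendsto)

lemma norm_sqrt_limit: "norm S \<le> 1 \<Longrightarrow> norm (sqrt_limit S) \<le> 1"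
  by (rule LIMSEQ_le_const2[OF tendsto_norm[OF sqrt_iter_tendsto]])
    (use norm_sqrt_iter_le sqrt_majorant_bounds order_trans in blast)+

lemma sqrt_limit_fixpoint:
  assumes "norm S \<le> 1"
  shows "sqrt_limit S = (1 / 2) *\<^sub>R (S + (sqrt_limit S o\<^sub>L sqrt_limit S))"
proof (rule LIMSEQ_unique)
  show "(\<lambda>n. sqrt_iter S (Suc n)) \<longlonglongrightarrow> sqrt_limit S"
    using sqrt_iter_tendsto[OF assms] by (rule LIMSEQ_Suc)
  show "(\<lambda>n. sqrt_iter S (Suc n)) \<longlonglongrightarrow> (1 / 2) *\<^sub>R (S + (sqrt_limit S o\<^sub>L sqrt_limit S))"
    unfolding sqrt_iter.simps
    by (intro tendsto_intros sqrt_iter_tendsto[OF assms]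
        bounded_bilinear.tendsto[OF bounded_bilinear_blinfun_compose])
qed

text \<open>Every iterate is a polynomial in \<open>S\<close>, so the intertwining relation passes
  to the iterates and to their limits. Three choices of \<open>X\<close> matter later: a complex
  scaling (complex linearity of the limit), another square root (uniqueness), and the contraction
  itself (exchange of its two defect operators).\<close>

lemma sqrt_limit_intertwine:
  assumes "norm S \<le> 1" "norm S' \<le> 1"
    and X: "bounded_linear X" "\<And>x. X (blinfun_apply S x) = blinfun_apply S' (X x)"
  shows "X (blinfun_apply (sqrt_limit S) x) = blinfun_apply (sqrt_limit S') (X x)"
proof (rule LIMSEQ_unique)
  have "X (blinfun_apply (sqrt_iter S n) x) = blinfun_apply (sqrt_iter S' n) (X x)" for n x
  proof (induction n arbitrary: x)
    case 0
    then show ?case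
      using X(1) by (simp add: linear_0 bounded_linear.linear)
  next
    case (Suc n)
    then show ?case
      using linear_add[OF bounded_linear.linear[OF X(1)]]
        linear_scale[OF bounded_linear.linear[OF X(1)]] X(2)
      by (simp add: blinfun.bilinear_simps)
  qed
  then show "(\<lambda>n. X (blinfun_apply (sqrt_iter S n) x)) \<longlonglongrightarrow> blinfun_apply (sqrt_limit S') (X x)"
    using sqrt_iter_apply_tendsto[OF assms(2)] by simp
  show "(\<lambda>n. X (blinfun_apply (sqrt_iter S n) x)) \<longlonglongrightarrow> X (blinfun_apply (sqrt_limit S) x)"
    by (intro bounded_linear.tendsto[OF X(1)] sqrt_iter_apply_tendsto assms)
qed

lemma sqrt_limit_selfadjoint:
  fixes S :: "'a::complex_hilbert_space \<Rightarrow>\<^sub>L 'a"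
  assumes "norm S \<le> 1" "\<And>x y. inner (blinfun_apply S x) y = inner x (blinfun_apply S y)"
  shows "inner (blinfun_apply (sqrt_limit S) x) y = inner x (blinfun_apply (sqrt_limit S) y)"
proof (rule LIMSEQ_unique)
  have "inner (blinfun_apply (sqrt_iter S n) x) y = inner x (blinfun_apply (sqrt_iter S n) y)" for n x y
    by (induction n arbitrary: x y) (simp_all add: blinfun.bilinear_simps inner_simps assms)
  then show "(\<lambda>n. inner (blinfun_apply (sqrt_iter S n) x) y) \<longlonglongrightarrow> inner x (blinfun_apply (sqrt_limit S) y)"
    using tendsto_inner[OF tendsto_const sqrt_iter_apply_tendsto[OF assms(1)]] by simp
  show "(\<lambda>n. inner (blinfun_apply (sqrt_iter S n) x) y) \<longlonglongrightarrow> inner (blinfun_apply (sqrt_limit S) x) y"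
    by (intro tendsto_inner tendsto_const sqrt_iter_apply_tendsto assms)
qed

section \<open>Defect operators of contractions\<close>

abbreviation contraction :: "('a::complex_hilbert_space \<Rightarrow> 'b::complex_hilbert_space) \<Rightarrow> bool"
  where "contraction A \<equiv> bop A \<and> (\<forall>x. norm (A x) \<le> norm x)"

lemma contraction_adj: "contraction A \<Longrightarrow> contraction (adj A)"
  using norm_adj_le[of A 1] bop_adj by auto

text \<open>Bundled as a bounded linear map, so that the operator norm and the iteration apply to
  it.\<close>

definition gram :: "('a::complex_hilbert_space \<Rightarrow> 'b::complex_hilbert_space) \<Rightarrow> 'a \<Rightarrow>\<^sub>L 'a"
  where "gram A = Blinfun (\<lambda>x. adj A (A x))"

lemma
  assumes "contraction A"
  shows gram_apply: "blinfun_apply (gram A) x = adj A (A x)"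
    and norm_gram: "norm (gram A) \<le> 1"
proof -
  have A: "bop A"
    using assms by simp
  have "bop (\<lambda>x. adj A (A x))"
    by (rule bop_comp[OF bop_adj[OF A] A])
  then show *: "blinfun_apply (gram A) x = adj A (A x)" for x
    unfolding gram_def by (simp add: bounded_linear_Blinfun_apply bop_bounded_linear)
  show "norm (gram A) \<le> 1"
  proof (rule norm_blinfun_bound)
    fix x
    have "norm (adj A (A x)) \<le> norm (A x)"
      using contraction_adj[OF assms] by blast
    then show "norm (blinfun_apply (gram A) x) \<le> 1 * norm x"
      using assms * by (simp, meson order_trans)
  qed simp
qed

lemma contraction_sqrt:
  assumes A: "contraction A"
  defines "B \<equiv> \<lambda>x. x - blinfun_apply (sqrt_limit (gram A)) x"
  shows "positive_op B" and "B (B x) = x - adj A (A x)"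
proof -
  note nG = norm_gram[OF A]
  define L where "L = blinfun_apply (sqrt_limit (gram A))"
  have L_le: "norm (L x) \<le> norm x" for x
  proof -
    have "norm (L x) \<le> norm (sqrt_limit (gram A)) * norm x"
      unfolding L_def by (rule norm_blinfun)
    also have "\<dots> \<le> 1 * norm x"
      by (intro mult_right_mono norm_sqrt_limit nG) simp
    finally show ?thesis
      by simp
  qed
  \<comment> \<open>The iteration takes place among real-linear maps; commuting with complex
    scalings makes its limit complex-linear.\<close>
  have Lc: "c *\<^sub>C L x = L (c *\<^sub>C x)" for c x
    unfolding L_def using A bop_adj[of A]
    by (intro sqrt_limit_intertwine nG bounded_linear_scaleC) (simp add: gram_apply[OF A] bop_scaleC)
  have L: "bop L"
  proof (rule bopI)
    show "norm (L x) \<le> 1 * norm x" for x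
      using L_le[of x] by simp
  qed (simp_all add: Lc, simp add: L_def blinfun.bilinear_simps)
  have Ladj: "inner (L x) y = inner x (L y)" for x y
    unfolding L_def
  proof (rule sqrt_limit_selfadjoint[OF nG])
    show "inner (blinfun_apply (gram A) x) y = inner x (blinfun_apply (gram A) y)" for x y
      using A cinner_adj[of A x "A y"] cinner_adj'[of A "A x" y]
      by (simp add: gram_apply Re_cinner[symmetric])
  qed
  have B: "bop B"
    unfolding B_def L_def[symmetric] by (intro bop_subtract bop_id L)
  have "cinner (B x) x \<in> \<real>\<^sub>\<ge>\<^sub>0" for x
  proof -
    have "inner (L x) x \<le> norm (L x) * norm x"
      by (rule norm_cauchy_schwarz)
    also have "\<dots> \<le> norm x * norm x"
      using L_le by (intro mult_right_mono) auto
    finally have "0 \<le> Re (cinner (B x) x)"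
      by (simp add: B_def L_def[symmetric] Re_cinner inner_simps dot_square_norm power2_eq_square)
    \<comment> \<open>Symmetry of \<open>L\<close> is available only for the real inner product;
      moving the factor \<open>\<i>\<close> across shows that this number equals its own
      negative.\<close>
    moreover have "inner (L x) (\<i> *\<^sub>C x) = 0"
    proof -
      have "inner (L x) (\<i> *\<^sub>C x) = inner x (\<i> *\<^sub>C L x)"
        by (simp add: Ladj Lc)
      also have "\<dots> = Im (cinner x (L x))"
        by (simp add: Im_cinner)
      also have "\<dots> = - Im (cinner (L x) x)"
        using cinner_commute[of x "L x"] by simp
      also have "\<dots> = - inner (L x) (\<i> *\<^sub>C x)"
        by (simp add: Im_cinner)
      finally show ?thesis
        by simp
    qed
    then have "Im (cinner (B x) x) = 0"
      by (simp add: B_def L_def[symmetric] cinner_diff_left cinner_self Im_cinner del: of_real_power)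
    ultimately show ?thesis
      by (simp add: complex_nonneg_Reals_iff)
  qed
  then show "positive_op B"
    using B by (simp add: positive_op_def)
  \<comment> \<open>The fixed point equation gives 2 L = G + L^2 with G the Gram operator, hence (I
    - L)^2 = I - G.\<close>
  have "L x = (1 / 2) *\<^sub>R (adj A (A x) + L (L x))" for x
    using arg_cong[OF sqrt_limit_fixpoint[OF nG], of "\<lambda>F. blinfun_apply F x"]
    by (simp add: L_def gram_apply[OF A] blinfun.bilinear_simps)
  then have "2 *\<^sub>R L x = adj A (A x) + L (L x)"
    by (metis (no_types, opaque_lifting) scaleR_scaleR mult.commute nonzero_mult_div_cancel_left
        scaleR_one times_divide_eq_right zero_neq_numeral)
  then show "B (B x) = x - adj A (A x)"
    by (simp add: B_def L_def[symmetric] bop_simps[OF L] scaleR_2 algebra_simps)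
qed

text \<open>\<open>C\<close> commutes with its own square, hence with the Gram operator and with the
  limit of the iteration, so uniqueness among commuting roots applies.\<close>

lemma contraction_sqrt_unique:
  assumes A: "contraction A" and C: "positive_op C" "\<And>x. C (C x) = x - adj A (A x)"
  shows "C = (\<lambda>x. x - blinfun_apply (sqrt_limit (gram A)) x)"
proof (rule commuting_sqrt_unique[OF C(1) contraction_sqrt(1)[OF A]])
  note bC = positive_op_bop[OF C(1)]
  fix x
  have "adj A (A x) = x - C (C x)" for x
    by (simp add: C(2))
  then have "C (blinfun_apply (sqrt_limit (gram A)) x) = blinfun_apply (sqrt_limit (gram A)) (C x)"
    using norm_gram[OF A] bop_bounded_linear[OF bC]
    by (intro sqrt_limit_intertwine) (simp_all add: gram_apply[OF A] bop_simps[OF bC])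
  then show "C (x - blinfun_apply (sqrt_limit (gram A)) x)
      = C x - blinfun_apply (sqrt_limit (gram A)) (C x)"
    by (simp add: bop_simps[OF bC])
  show "C (C x) = x - blinfun_apply (sqrt_limit (gram A)) x
      - blinfun_apply (sqrt_limit (gram A)) (x - blinfun_apply (sqrt_limit (gram A)) x)"
    using contraction_sqrt(2)[OF A, of x] by (simp add: C(2))
qed

lemma defect_eq_limit:
  assumes "contraction A"
  shows "defect A = (\<lambda>x. x - blinfun_apply (sqrt_limit (gram A)) x)"
  unfolding defect_def sqrt_op_def
proof (rule the_equality)
  fix C
  assume "positive_op C \<and> C \<circ> C = (\<lambda>x. x - adj A (A x))"
  then show "C = (\<lambda>x. x - blinfun_apply (sqrt_limit (gram A)) x)"
    by (intro contraction_sqrt_unique[OF assms]) (auto simp: fun_eq_iff)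
qed (use contraction_sqrt[OF assms] in auto)

lemma
  assumes "contraction A"
  shows positive_defect: "positive_op (defect A)"
    and defect_defect: "defect A (defect A x) = x - adj A (A x)"
  using contraction_sqrt[OF assms] by (simp_all add: defect_eq_limit[OF assms])

lemma defect_unique:
  assumes "contraction A" "positive_op C" "\<And>x. C (C x) = x - adj A (A x)"
  shows "defect A = C"
  using contraction_sqrt_unique[OF assms] defect_eq_limit[OF assms(1)] by simp

lemma defect_star_eq: "bop A \<Longrightarrow> defect_star A = defect (adj A)"
  by (simp add: defect_def defect_star_def adj_adj)

text \<open>\<open>A\<close> intertwines the Gram operators of \<open>A\<close> and of
  \<open>adj A\<close>, hence also their square root limits.\<close>

lemma defect_intertwine:
  assumes A: "contraction A"
  shows "A (defect A x) = defect_star A (A x)"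
proof -
  have "A (blinfun_apply (sqrt_limit (gram A)) x) = blinfun_apply (sqrt_limit (gram (adj A))) (A x)"
    using A contraction_adj[OF A]
    by (intro sqrt_limit_intertwine norm_gram bop_bounded_linear) (auto simp: gram_apply adj_adj)
  then show ?thesis
    using A contraction_adj[OF A] by (simp add: defect_star_eq defect_eq_limit bop_diff)
qed

section \<open>Neumann inverses, rows and columns\<close>

text \<open>Injectivity and the bound for the inverse follow from norm (h - L h) \<ge> (1 - c) norm
  h; surjectivity holds because \<open>k + L h\<close> is a strict contraction of \<open>h\<close>
  and so has a fixed point.\<close>

lemma neumann:
  fixes L :: "'a::complex_hilbert_space \<Rightarrow> 'a"
  assumes L: "bop L" and c: "0 \<le> c" "c < 1" and L_le: "\<And>x. norm (L x) \<le> c * norm x"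
  shows neumann_bij: "bij (\<lambda>h. h - L h)"
    and neumann_bop: "bop (inv (\<lambda>h. h - L h))"
proof -
  let ?f = "\<lambda>h. h - L h"
  have lower: "(1 - c) * norm h \<le> norm (?f h)" for h
    using L_le[of h] norm_triangle_ineq2[of h "L h"] by (simp add: algebra_simps)
  have f: "bop ?f"
    by (intro bop_subtract bop_id L)
  have inj: "inj ?f"
  proof (rule injI)
    fix h h'
    assume "?f h = ?f h'"
    then have "?f (h - h') = 0"
      by (simp add: bop_simps[OF L] algebra_simps)
    then have "(1 - c) * norm (h - h') \<le> 0"
      using lower[of "h - h'"] by simp
    then show "h = h'"
      using c by (simp add: mult_le_0_iff)
  qed
  have "\<exists>h. ?f h = k" for k
  proof -
    have "\<exists>!h. k + L h = h"
    proof (rule banach_fix_type[OF c])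
      show "\<forall>x y. dist (k + L x) (k + L y) \<le> c * dist x y"
        using L_le by (simp add: dist_norm bop_diff[OF L, symmetric])
    qed
    then show ?thesis
      by (metis add_diff_cancel_right')
  qed
  then have surj: "surj ?f"
    by (metis surjI)
  show bij: "bij ?f"
    using inj surj by (rule bijI)
  have f_inv: "?f (inv ?f k) = k" for k
    using surj by (rule surj_f_inv_f)
  show "bop (inv ?f)"
  proof (rule bopI)
    fix x y c'
    show "inv ?f (x + y) = inv ?f x + inv ?f y"
      using inj by (rule inv_f_eq) (metis (no_types, lifting) f_inv bop_add[OF f])
    show "inv ?f (c' *\<^sub>C x) = c' *\<^sub>C inv ?f x"
      using inj by (rule inv_f_eq) (metis (no_types, lifting) f_inv bop_scaleC[OF f])
    show "norm (inv ?f x) \<le> 1 / (1 - c) * norm x"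
      using lower[of "inv ?f x"] c by (simp add: f_inv field_simps)
  qed
qed

lemma norm_col: "norm (col z h) = norm z * norm h"
proof (rule power2_eq_imp_eq)
  have "(norm (col z h))\<^sup>2 = (\<Sum>j\<in>UNIV. (norm (z $ j))\<^sup>2 * (norm h)\<^sup>2)"
    by (simp add: norm_vec_def L2_set_def col_def norm_scaleC power_mult_distrib sum_nonneg)
  also have "\<dots> = (norm z * norm h)\<^sup>2"
    by (simp add: norm_vec_def L2_set_def sum_distrib_right[symmetric] power_mult_distrib sum_nonneg)
  finally show "(norm (col z h))\<^sup>2 = (norm z * norm h)\<^sup>2" .
qed auto

lemma bop_col: "bop (col z)"
proof (rule bopI)
  show "norm (col z x) \<le> norm z * norm x" for x :: 'a
    by (simp add: norm_col)
qed (simp_all add: col_def vec_eq_iff scaleC_add_right scaleC_vec_def scaleC_scaleC mult.commute)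

lemma cinner_col: "cinner (col z h) x = cinner h (row z x)"
  unfolding row_def by (rule cinner_adj[OF bop_col])

lemma bop_row: "bop (row z)"
  unfolding row_def by (rule bop_adj[OF bop_col])

lemma norm_row: "norm (row z x) \<le> norm z * norm x"
  unfolding row_def by (rule norm_adj_le[OF bop_col]) (simp_all add: norm_col)

lemma cinner_col_col:
  "cinner (col w h) (col z k) = (\<Sum>j\<in>UNIV. z $ j * cnj (w $ j)) * cinner h k"
  by (simp add: cinner_vec_def col_def cinner_simps sum_distrib_left mult_ac)

section \<open>A criterion for membership in the Schur class\<close>

lemma
  assumes "rkhs \<Omega> k J F ip"
  shows rkhs_mem: "f \<in> F \<Longrightarrow> z \<in> \<Omega> \<Longrightarrow> f z \<in> J"
    and rkhs_outside: "f \<in> F \<Longrightarrow> z \<notin> \<Omega> \<Longrightarrow> f z = 0"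
    and rkhs_zero: "0 \<in> F"
    and rkhs_add: "f \<in> F \<Longrightarrow> g \<in> F \<Longrightarrow> f + g \<in> F"
    and rkhs_scaleC: "f \<in> F \<Longrightarrow> (\<lambda>z. c *\<^sub>C f z) \<in> F"
    and rkhs_ip_add: "f \<in> F \<Longrightarrow> g \<in> F \<Longrightarrow> h \<in> F \<Longrightarrow> ip (f + g) h = ip f h + ip g h"
    and rkhs_ip_scaleC: "f \<in> F \<Longrightarrow> g \<in> F \<Longrightarrow> ip (\<lambda>z. c *\<^sub>C f z) g = c * ip f g"
    and rkhs_ip_cnj: "f \<in> F \<Longrightarrow> g \<in> F \<Longrightarrow> ip f g = cnj (ip g f)"
    and rkhs_ip_nonneg: "f \<in> F \<Longrightarrow> 0 \<le> Re (ip f f)"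
    and rkhs_kernel_mem: "w \<in> \<Omega> \<Longrightarrow> x \<in> J \<Longrightarrow> kernel_fun \<Omega> k w x \<in> F"
    and rkhs_ip_kernel: "w \<in> \<Omega> \<Longrightarrow> x \<in> J \<Longrightarrow> f \<in> F \<Longrightarrow> ip f (kernel_fun \<Omega> k w x) = cinner (f w) x"
proof -
  note c = assms[unfolded rkhs_def]
  note c1 = conjunct1[OF c] and r1 = conjunct2[OF c]
  note c2 = conjunct1[OF r1] and r2 = conjunct2[OF r1]
  note c3 = conjunct1[OF r2] and r3 = conjunct2[OF r2]
  note c4 = conjunct1[OF r3] and r4 = conjunct2[OF r3]
  note c5 = conjunct1[OF r4] and r5 = conjunct2[OF r4]
  note c6 = conjunct1[OF r5] and r6 = conjunct2[OF r5]
  note c7 = conjunct1[OF r6] and r7 = conjunct2[OF r6]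
  note c8 = conjunct1[OF r7] and r8 = conjunct2[OF r7]
  \<comment> \<open>The ninth conjunct, completeness, is extracted separately in
    \<open>rkhs_complete\<close>.\<close>
  note c10 = conjunct2[OF r8]
  show "f \<in> F \<Longrightarrow> z \<in> \<Omega> \<Longrightarrow> f z \<in> J" "f \<in> F \<Longrightarrow> z \<notin> \<Omega> \<Longrightarrow> f z = 0"
    using c1 by blast+
  \<comment> \<open>Pointwise operations are restated through the group structure on functions, the
    form in which \<open>riesz_relation\<close> takes them.\<close>
  show "0 \<in> F"
    using c2 by (simp only: zero_fun_def)
  show "f \<in> F \<Longrightarrow> g \<in> F \<Longrightarrow> f + g \<in> F"
    using c3 by (simp only: plus_fun_def)
  show "f \<in> F \<Longrightarrow> (\<lambda>z. c *\<^sub>C f z) \<in> F"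
    using c4 by blast
  show "f \<in> F \<Longrightarrow> g \<in> F \<Longrightarrow> h \<in> F \<Longrightarrow> ip (f + g) h = ip f h + ip g h"
    using c5 by (simp only: plus_fun_def)
  show "f \<in> F \<Longrightarrow> g \<in> F \<Longrightarrow> ip (\<lambda>z. c *\<^sub>C f z) g = c * ip f g"
    using c6 by blast
  show "f \<in> F \<Longrightarrow> g \<in> F \<Longrightarrow> ip f g = cnj (ip g f)"
    using c7 by blast
  show "f \<in> F \<Longrightarrow> 0 \<le> Re (ip f f)"
    using c8 by blast
  show "w \<in> \<Omega> \<Longrightarrow> x \<in> J \<Longrightarrow> kernel_fun \<Omega> k w x \<in> F"
    "w \<in> \<Omega> \<Longrightarrow> x \<in> J \<Longrightarrow> f \<in> F \<Longrightarrow> ip f (kernel_fun \<Omega> k w x) = cinner (f w) x"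
    using c10 by blast+
qed

lemma rkhs_complete:
  assumes "rkhs \<Omega> k J F ip" "\<And>n::nat. u n \<in> F"
    "\<And>e. e > 0 \<Longrightarrow> \<exists>N. \<forall>m\<ge>N. \<forall>n\<ge>N. Re (ip (u m - u n) (u m - u n)) < e"
  shows "\<exists>f\<in>F. (\<lambda>n. Re (ip (u n - f) (u n - f))) \<longlonglongrightarrow> 0"
proof -
  have "\<forall>u. (\<forall>n::nat. u n \<in> F) \<and>
      (\<forall>e>0. \<exists>N. \<forall>m\<ge>N. \<forall>n\<ge>N. Re (ip (\<lambda>z. u m z - u n z) (\<lambda>z. u m z - u n z)) < e) \<longrightarrow>
      (\<exists>f\<in>F. (\<lambda>n. Re (ip (\<lambda>z. u n z - f z) (\<lambda>z. u n z - f z))) \<longlonglongrightarrow> 0)"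
    using assms(1) unfolding rkhs_def by blast
  then show ?thesis
    using assms(2,3) unfolding fun_diff_def by blast
qed

lemma rkhs_ip_add_right:
  assumes "rkhs \<Omega> k J F ip" "f \<in> F" "g \<in> F" "h \<in> F"
  shows "ip h (f + g) = ip h f + ip h g"
  using assms rkhs_ip_cnj[OF assms(1), of h] by (simp add: rkhs_ip_add rkhs_add)

lemma rkhs_ip_scaleC_right:
  assumes "rkhs \<Omega> k J F ip" "f \<in> F" "g \<in> F"
  shows "ip g (\<lambda>z. c *\<^sub>C f z) = cnj c * ip g f"
  using assms rkhs_ip_cnj[OF assms(1), of g] by (simp add: rkhs_ip_scaleC rkhs_scaleC)

lemma rkhs_ip_zero:
  assumes "rkhs \<Omega> k J F ip" "f \<in> F"
  shows "ip 0 f = 0" "ip f 0 = 0"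
proof -
  show "ip 0 f = 0"
    using rkhs_ip_add[OF assms(1), of 0 0 f] rkhs_zero[OF assms(1)] assms(2) by simp
  then show "ip f 0 = 0"
    using rkhs_ip_cnj[OF assms(1), of f 0] rkhs_zero[OF assms(1)] assms(2) by simp
qed

lemma rkhs_Cauchy_Schwarz:
  assumes F: "rkhs \<Omega> k J F ip" and f: "f \<in> F" and g: "g \<in> F"
  shows "(Re (ip f g))\<^sup>2 \<le> Re (ip f f) * Re (ip g g)"
proof (rule quadratic_discriminant[OF rkhs_ip_nonneg[OF F g]])
  fix r
  define rg where "rg = (\<lambda>z. complex_of_real r *\<^sub>C g z)"
  have rg: "rg \<in> F"
    unfolding rg_def by (rule rkhs_scaleC[OF F g])
  have "0 \<le> Re (ip (f + rg) (f + rg))"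
    by (intro rkhs_ip_nonneg[OF F] rkhs_add[OF F] f rg)
  also have "ip (f + rg) (f + rg) = ip f f + ip f rg + ip rg f + ip rg rg"
    by (simp add: rkhs_ip_add[OF F] rkhs_ip_add_right[OF F] rkhs_add[OF F] f rg)
  also have "Re \<dots> = Re (ip f f) + 2 * r * Re (ip f g) + r\<^sup>2 * Re (ip g g)"
    using rkhs_ip_cnj[OF F g f]
    by (simp add: rg_def rkhs_ip_scaleC[OF F] rkhs_ip_scaleC_right[OF F] rkhs_scaleC[OF F] f g
        power2_eq_square)
  finally show "0 \<le> Re (ip f f) + 2 * r * Re (ip f g) + r\<^sup>2 * Re (ip g g)" .
qed

text \<open>The third component realises the positive kernel
  \<open>(\<langle>y, y'\<rangle> - \<langle>b(w)\<^sup>*y, b(z)\<^sup>*y'\<rangle>) k(z,w)\<close> as a Gram kernel, so that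
  \<open>\<parallel>h\<parallel>\<^sup>2 = \<parallel>h'\<parallel>\<^sup>2 + \<parallel>g\<parallel>\<^sup>2\<close> for every triple \<open>(h, h', g)\<close>.\<close>

inductive_set kernel_triples ::
  "'p set \<Rightarrow> ('p \<Rightarrow> 'p \<Rightarrow> complex) \<Rightarrow> 'b::complex_hilbert_space set \<Rightarrow>
   ('p \<Rightarrow> 'b \<Rightarrow> 'a::complex_hilbert_space) \<Rightarrow> ('p \<Rightarrow> 'b \<Rightarrow> 'c::complex_hilbert_space) \<Rightarrow>
   (('p \<Rightarrow> 'b) \<times> ('p \<Rightarrow> 'a) \<times> 'c) set"
  for \<Omega> k K Bst \<Gamma> where
  zero: "(0, 0, 0) \<in> kernel_triples \<Omega> k K Bst \<Gamma>"
| step: "(h, h', g) \<in> kernel_triples \<Omega> k K Bst \<Gamma> \<Longrightarrow> w \<in> \<Omega> \<Longrightarrow> y \<in> K \<Longrightarrow>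
    (h + (\<lambda>z. c *\<^sub>C kernel_fun \<Omega> k w y z), h' + (\<lambda>z. c *\<^sub>C kernel_fun \<Omega> k w (Bst w y) z),
      g + c *\<^sub>C \<Gamma> w y) \<in> kernel_triples \<Omega> k K Bst \<Gamma>"

lemma kernel_triples_add:
  assumes "(h, h', g) \<in> kernel_triples \<Omega> k K Bst \<Gamma>" "(u, u', v) \<in> kernel_triples \<Omega> k K Bst \<Gamma>"
  shows "(h + u, h' + u', g + v) \<in> kernel_triples \<Omega> k K Bst \<Gamma>"
  using assms(2)
proof (induction u u' v)
  case zero
  then show ?case
    using assms(1) by simp
next
  case (step u u' v w y c)
  then show ?case
    using kernel_triples.step[OF step.IH step.hyps(2,3), of c] by (simp only: add.assoc)
qed

lemma kernel_triples_scaleC: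
  assumes "(h, h', g) \<in> kernel_triples \<Omega> k K Bst \<Gamma>"
  shows "((\<lambda>z. a *\<^sub>C h z), (\<lambda>z. a *\<^sub>C h' z), a *\<^sub>C g) \<in> kernel_triples \<Omega> k K Bst \<Gamma>"
  using assms
proof (induction h h' g)
  case zero
  then show ?case
    using kernel_triples.zero by (simp add: zero_fun_def)
next
  case (step u u' v w y c)
  then show ?case
    using kernel_triples.step[OF step.IH step.hyps(2,3), of "a * c"]
    by (simp add: plus_fun_def scaleC_add_right scaleC_scaleC)
qed

text \<open>The Gram identity makes the map from the kernel function of \<open>y\<close> at
  \<open>w\<close> to that of \<open>Bst w y\<close> at \<open>w\<close> contractive on spans. For
  \<open>f\<close> in the first space, pairing \<open>f\<close> with the image is therefore a
  functional bounded by the norm of \<open>f\<close>; its Riesz representative \<open>p\<close> in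
  the second space has at most that norm, and the reproducing property shows that \<open>p\<close>
  is the product of \<open>b\<close> and \<open>f\<close>.\<close>

lemma schur_classI:
  fixes b :: "complex ^ 'd::finite \<Rightarrow> 'a::complex_hilbert_space \<Rightarrow> 'b::complex_hilbert_space"
    and \<Gamma> :: "complex ^ 'd \<Rightarrow> 'b \<Rightarrow> 'c::complex_hilbert_space"
  assumes K: "complex_vector.subspace K"
    and b: "\<And>z. z \<in> unit_ball \<Longrightarrow> b z \<in> bounded_ops J K"
    and Bst: "\<And>w y. w \<in> unit_ball \<Longrightarrow> y \<in> K \<Longrightarrow> Bst w y \<in> J"
    and adj: "\<And>w x y. w \<in> unit_ball \<Longrightarrow> x \<in> J \<Longrightarrow> y \<in> K \<Longrightarrow> cinner (b w x) y = cinner x (Bst w y)"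
    and gram: "\<And>w z y y'. w \<in> unit_ball \<Longrightarrow> z \<in> unit_ball \<Longrightarrow> y \<in> K \<Longrightarrow> y' \<in> K \<Longrightarrow>
      cinner y y' - cinner (Bst w y) (Bst z y')
      = (1 - (\<Sum>j\<in>UNIV. z $ j * cnj (w $ j))) * cinner (\<Gamma> w y) (\<Gamma> z y')"
  shows "b \<in> schur_class J K"
proof -
  have key: "multiply b f \<in> G \<and> Re (ipG (multiply b f) (multiply b f)) \<le> Re (ipF f f)"
    if F: "rkhs unit_ball da_kernel J F ipF" and G: "rkhs unit_ball da_kernel K G ipG" and f: "f \<in> F"
    for F ipF G ipG f
  proof -
    let ?R = "kernel_triples unit_ball da_kernel K Bst \<Gamma>"
    let ?k = "kernel_fun unit_ball da_kernel"
    note kG = rkhs_kernel_mem[OF G] rkhs_ip_kernel[OF G]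
      and kF = rkhs_kernel_mem[OF F] rkhs_ip_kernel[OF F]
    have mem: "h \<in> G \<and> h' \<in> F" if "(h, h', g) \<in> ?R" for h h' g
      using that
    proof (induction h h' g)
      case zero
      show ?case
        using rkhs_zero[OF F] rkhs_zero[OF G] by (rule conjI[rotated])
    next
      case (step h h' g w y c)
      then show ?case
        by (intro conjI rkhs_add[OF F] rkhs_add[OF G] rkhs_scaleC[OF F] rkhs_scaleC[OF G] kG(1)
            kF(1) Bst) blast+
    qed
    have nz: "1 - (\<Sum>j\<in>UNIV. z $ j * cnj (w $ j)) \<noteq> 0"
      if "z \<in> unit_ball" "w \<in> unit_ball" for z w :: "complex ^ 'd"
    proof
      assume "1 - (\<Sum>j\<in>UNIV. z $ j * cnj (w $ j)) = 0"
      then have "cinner z w = 1"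
        by (simp add: cinner_vec_def cinner_complex_def)
      then have "inner z w = 1"
        by (metis Re_cinner one_complex.simps(1))
      moreover have "inner z w \<le> norm z * norm w"
        by (rule norm_cauchy_schwarz)
      moreover have "norm z * norm w \<le> norm z * 1"
        using that by (intro mult_left_mono) auto
      ultimately show False
        using that by simp
    qed
    \<comment> \<open>The kernel value is the reciprocal of the scalar factor in the Gram identity,
      so the two cancel.\<close>
    have gen: "ipG (?k w y) (?k z y') = ipF (?k w (Bst w y)) (?k z (Bst z y')) + cinner (\<Gamma> w y) (\<Gamma> z y')"
      if "w \<in> unit_ball" "z \<in> unit_ball" "y \<in> K" "y' \<in> K" for w z y y'
    proof -
      have "ipG (?k w y) (?k z y') - ipF (?k w (Bst w y)) (?k z (Bst z y'))
          = da_kernel z w * (cinner y y' - cinner (Bst w y) (Bst z y'))"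
        using that by (simp add: kG kF Bst) (simp add: kernel_fun_def cinner_scaleC_left algebra_simps)
      also have "\<dots> = cinner (\<Gamma> w y) (\<Gamma> z y')"
      proof -
        have "1 / c * (c * x) = x" if "c \<noteq> 0" for c x :: complex
          using that by simp
        from this[OF nz[OF that(2,1)]] show ?thesis
          unfolding gram[OF that] da_kernel_def .
      qed
      finally show ?thesis
        by (simp add: algebra_simps)
    qed
    have iso1: "ipG (?k w y) u = ipF (?k w (Bst w y)) u' + cinner (\<Gamma> w y) v"
      if "(u, u', v) \<in> ?R" "w \<in> unit_ball" "y \<in> K" for u u' v w y
      using that(1)
    proof (induction u u' v)
      case zero
      then show ?case
        using that by (simp add: rkhs_ip_zero[OF F] rkhs_ip_zero[OF G] kG kF Bst
            del: plus_fun_apply zero_fun_apply)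
    next
      case (step u u' v z y' c)
      then show ?case
        using that mem[OF step.hyps(1)]
        by (simp add: rkhs_ip_add_right[OF F] rkhs_ip_add_right[OF G] rkhs_ip_scaleC_right[OF F]
            rkhs_ip_scaleC_right[OF G] rkhs_scaleC[OF F] rkhs_scaleC[OF G] kG(1) kF(1) Bst gen
            cinner_simps algebra_simps del: plus_fun_apply zero_fun_apply)
    qed
    have iso: "ipG h u = ipF h' u' + cinner g v"
      if "(h, h', g) \<in> ?R" "(u, u', v) \<in> ?R" for h h' g u u' v
      using that(1)
    proof (induction h h' g)
      case zero
      then show ?case
        using mem[OF that(2)] by (simp add: rkhs_ip_zero[OF F] rkhs_ip_zero[OF G]
            del: plus_fun_apply zero_fun_apply)
    next
      case (step h h' g w y c)
      then show ?case
        using mem[OF step.hyps(1)] mem[OF that(2)]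
        by (simp add: rkhs_ip_add[OF F] rkhs_ip_add[OF G] rkhs_ip_scaleC[OF F]
            rkhs_ip_scaleC[OF G] rkhs_scaleC[OF F] rkhs_scaleC[OF G] kG(1) kF(1) Bst
            iso1[OF that(2)] cinner_simps algebra_simps del: plus_fun_apply zero_fun_apply)
    qed
    \<comment> \<open>The graph of the functional on the span of kernel functions; \<open>h'\<close>
      is attached to a chosen representation of \<open>h\<close> as a combination, hence a
      relation.\<close>
    define S where "S = {(h, Re (ipF f h')) | h h'. \<exists>g. (h, h', g) \<in> ?R}"
    have S_I: "(h, t) \<in> S" if "(h, q, g) \<in> ?R" "t = Re (ipF f q)" for h q g t
      using that unfolding S_def by blast
    have S_E: "\<exists>q g. (h, q, g) \<in> ?R \<and> t = Re (ipF f q)" if "(h, t) \<in> S" for h t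
      using that unfolding S_def by blast
    obtain p where p: "p \<in> G" "\<And>h t. (h, t) \<in> S \<Longrightarrow> Re (ipG p h) = t"
      "Re (ipG p p) \<le> Re (ipF f f)"
    proof (rule riesz_relation[of G "\<lambda>r h z. complex_of_real r *\<^sub>C h z" "\<lambda>x y. Re (ipG x y)" S
          "Re (ipF f f)"])
      show "(\<lambda>z. complex_of_real (- 1) *\<^sub>C x z) = - x" for x :: "complex ^ 'd \<Rightarrow> 'b"
        using scaleC_of_real[of "- 1"] by (simp add: fun_eq_iff)
      show "Re (ipG x w) = Re (ipG w x)" if "x \<in> G" "w \<in> G" for x w
        using rkhs_ip_cnj[OF G that] by simp
      show "\<exists>f\<in>G. (\<lambda>n. Re (ipG (u n - f) (u n - f))) \<longlonglongrightarrow> 0"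
        if "\<And>n. u n \<in> G" "\<And>e. e > 0 \<Longrightarrow> \<exists>N. \<forall>m\<ge>N. \<forall>n\<ge>N. Re (ipG (u m - u n) (u m - u n)) < e" for u
        using rkhs_complete[OF G that] .
      show "h \<in> G" if "(h, t) \<in> S" for h t
        using S_E[OF that] mem by blast
      show "S \<noteq> {}"
        using S_I[OF kernel_triples.zero refl] by blast
      show "(h + h', t + t') \<in> S" if "(h, t) \<in> S" "(h', t') \<in> S" for h t h' t'
      proof -
        obtain q g q' g' where *: "(h, q, g) \<in> ?R" "t = Re (ipF f q)" "(h', q', g') \<in> ?R"
          "t' = Re (ipF f q')"
          using S_E[OF \<open>(h, t) \<in> S\<close>] S_E[OF \<open>(h', t') \<in> S\<close>] by blast
        have "t + t' = Re (ipF f (q + q'))"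
          using * mem f by (simp add: rkhs_ip_add_right[OF F])
        then show ?thesis
          by (rule S_I[OF kernel_triples_add[OF *(1,3)]])
      qed
      show "((\<lambda>z. complex_of_real r *\<^sub>C h z), r * t) \<in> S" if "(h, t) \<in> S" for r h t
      proof -
        obtain q g where *: "(h, q, g) \<in> ?R" "t = Re (ipF f q)"
          using S_E[OF \<open>(h, t) \<in> S\<close>] by blast
        have "r * t = Re (ipF f (\<lambda>z. complex_of_real r *\<^sub>C q z))"
          using * mem f by (simp add: rkhs_ip_scaleC_right[OF F])
        then show ?thesis
          by (rule S_I[OF kernel_triples_scaleC[OF *(1)]])
      qed
      show "t\<^sup>2 \<le> Re (ipF f f) * Re (ipG h h)" if "(h, t) \<in> S" for h t
      proof -
        obtain q g where *: "(h, q, g) \<in> ?R" "t = Re (ipF f q)"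
          using S_E[OF \<open>(h, t) \<in> S\<close>] by blast
        have "t\<^sup>2 \<le> Re (ipF f f) * Re (ipF q q)"
          using * mem f by (auto intro: rkhs_Cauchy_Schwarz[OF F])
        \<comment> \<open>By \<open>iso\<close>, the squared norm of \<open>h\<close> exceeds that
          of \<open>q\<close> by the squared norm of \<open>g\<close>.\<close>
        also have "\<dots> \<le> Re (ipF f f) * Re (ipG h h)"
          using iso[OF *(1) *(1)] rkhs_ip_nonneg[OF F f]
          by (intro mult_left_mono) (simp_all add: cinner_self)
        finally show ?thesis .
      qed
    qed (auto simp: rkhs_add[OF G] rkhs_scaleC[OF G] rkhs_ip_add[OF G] rkhs_ip_scaleC[OF G]
        rkhs_ip_nonneg[OF G] rkhs_ip_nonneg[OF F f])
    have "p = multiply b f"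
    proof
      fix w
      show "p w = multiply b f w"
      proof (cases "w \<in> unit_ball")
        case True
        have fw: "f w \<in> J" and pw: "p w \<in> K" and bfw: "b w (f w) \<in> K"
          using rkhs_mem[OF F f True] rkhs_mem[OF G p(1) True] bounded_ops_mem[OF b[OF True]] by auto
        \<comment> \<open>Both sides are pairings with kernel functions at \<open>w\<close>. Real
          parts suffice, since \<open>y\<close> is later taken to be the difference of the two
          vectors.\<close>
        have "inner (p w) y = inner (b w (f w)) y" if "y \<in> K" for y
        proof -
          have "(?k w y, ?k w (Bst w y), \<Gamma> w y) \<in> ?R"
            using kernel_triples.step[OF kernel_triples.zero True that, where c = 1]
            by (simp add: complex_vector.scale_one del: plus_fun_apply zero_fun_apply)
          then have "Re (ipG p (?k w y)) = Re (ipF f (?k w (Bst w y)))"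
            by (rule p(2)[OF S_I[OF _ refl]])
          then have "Re (cinner (p w) y) = Re (cinner (f w) (Bst w y))"
            using True that p(1) f by (simp add: kG kF Bst)
          then show ?thesis
            using adj[OF True fw that] by (metis Re_cinner)
        qed
        then have "inner (p w - b w (f w)) (p w - b w (f w)) = 0"
          using complex_vector.subspace_diff[OF K pw bfw] by (simp only: inner_diff_left)
        then show ?thesis
          using True by (simp add: multiply_def)
      next
        case False
        then show ?thesis
          using rkhs_outside[OF G p(1) False] by (simp only: multiply_def if_False)
      qed
    qed
    then show ?thesis
      using p by blast
  qed
  show ?thesis
    unfolding schur_class_def
  proof (intro CollectI conjI allI impI ballI)
    fix F :: "(complex ^ 'd \<Rightarrow> 'a) set" and ipF and G :: "(complex ^ 'd \<Rightarrow> 'b) set" and ipG f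
    assume R: "rkhs unit_ball da_kernel J F ipF \<and> rkhs unit_ball da_kernel K G ipG" and f: "f \<in> F"
    note * = key[OF conjunct1[OF R] conjunct2[OF R] f]
    show "multiply b f \<in> G"
      by (rule conjunct1[OF *])
    show "Re (ipG (multiply b f) (multiply b f)) \<le> Re (ipF f f)"
      by (rule conjunct2[OF *])
  qed (rule b)
qed

section \<open>Isometries onto subspaces\<close>

text \<open>Polarisation turns preservation of norms into preservation of inner products.
  Consequently \<open>adj U\<close> inverts \<open>U\<close>, and \<open>U\<close> after
  \<open>adj U\<close> is the projection onto \<open>M\<close>.\<close>

lemma
  assumes U: "onto_isometry UNIV M U"
  shows onto_isometry_bop: "bop U"
    and onto_isometry_mem: "U x \<in> M"
    and onto_isometry_adj_left: "adj U (U x) = x"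
    and onto_isometry_adj_right: "y \<in> M \<Longrightarrow> U (adj U y) = y"
    and onto_isometry_ortho: "y - U (adj U y) \<in> ortho M"
    and onto_isometry_cinner: "cinner (U x) (U x') = cinner x x'"
proof -
  have n: "norm (U x) = norm x" for x
    using U by (simp add: onto_isometry_def)
  show B: "bop U"
    using U bounded_ops_mono_range[of U UNIV M UNIV] by (auto simp: onto_isometry_def)
  show "U x \<in> M" for x
    using U by (auto simp: onto_isometry_def)
  have i: "inner (U x) (U y) = inner x y" for x y
    by (simp add: dot_norm bop_add[OF B, symmetric] n)
  show c: "cinner (U x) (U y) = cinner x y" for x y
    using i[of x y] i[of x "\<i> *\<^sub>C y"]
    by (simp add: complex_eq_iff Re_cinner Im_cinner bop_scaleC[OF B])
  show l: "adj U (U x) = x" for x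
    by (rule adj_eqI) (rule c)
  show "U (adj U y) = y" if "y \<in> M" for y
    using U that l by (auto simp: onto_isometry_def)
  have "cinner (y - U (adj U y)) m = 0" if m: "m \<in> M" for m
  proof -
    obtain x where "m = U x"
      using U m by (auto simp: onto_isometry_def)
    then show ?thesis
      using cinner_adj'[OF B, of y x] c by (simp add: cinner_diff_left)
  qed
  then show "y - U (adj U y) \<in> ortho M"
    by (simp add: ortho_def)
qed

lemma onto_isometry_norm_diff:
  assumes U: "onto_isometry UNIV M U"
  shows "norm (y - U (adj U y)) \<le> norm y"
proof (cases "y - U (adj U y) = 0")
  case False
  let ?p = "U (adj U y)"
  have "cinner (y - ?p) ?p = 0"
    using ortho_sym[OF onto_isometry_ortho[OF U] onto_isometry_mem[OF U]] by blast
  then have "cinner (y - ?p) (y - ?p) = cinner (y - ?p) y"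
    by (simp only: cinner_diff_right) simp
  then have "(norm (y - ?p))\<^sup>2 = inner (y - ?p) y"
    by (metis Re_cinner dot_square_norm)
  also have "\<dots> \<le> norm (y - ?p) * norm y"
    by (rule norm_cauchy_schwarz)
  finally show ?thesis
    using False by (simp add: power2_eq_square)
qed simp

lemma positive_op_compress:
  assumes U: "bop U" and P: "positive_op P"
  shows "positive_op (\<lambda>x. adj U (P (U x)))"
proof -
  note bP = positive_op_bop[OF P]
  have "cinner (adj U (P (U x))) x = cinner (P (U x)) (U x)" for x
    by (simp add: cinner_adj'[OF U])
  then show ?thesis
    using bop_comp[OF bop_adj[OF U] bop_comp[OF bP U]] P by (simp add: positive_op_def)
qed

section \<open>The Sz.-Nagy--Foias characteristic function\<close>

locale row_contractive =
  fixes T :: "'h::complex_hilbert_space ^ 'd::finite \<Rightarrow> 'h"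
  assumes T: "row_contraction T"
begin

definition resolvent :: "complex ^ 'd \<Rightarrow> 'h \<Rightarrow> 'h"
  where "resolvent z = inv (\<lambda>h. h - row z (adj T h))"

definition coresolvent :: "complex ^ 'd \<Rightarrow> 'h \<Rightarrow> 'h"
  where "coresolvent z = inv (\<lambda>h. h - T (col z h))"

text \<open>On \<open>closure (range (defect_star T))\<close> this is the adjoint of \<open>\<Theta>\<^sub>T(z)\<close>.\<close>

definition theta_adj :: "complex ^ 'd \<Rightarrow> 'h \<Rightarrow> 'h ^ 'd"
  where "theta_adj z y = defect T (col z (coresolvent z (defect_star T y))) - adj T y"

section \<open>Defect operators and defect spaces of T\<close>

lemma contraction_T: "contraction T"
  using T by (simp add: row_contraction_def)

lemma bop_T: "bop T"
  using contraction_T by blast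

lemma norm_T: "norm (T x) \<le> norm x"
  using contraction_T by blast

lemma bop_adj_T: "bop (adj T)"
  using contraction_adj[OF contraction_T] by blast

lemma norm_adj_T: "norm (adj T h) \<le> norm h"
  using contraction_adj[OF contraction_T] by blast

lemma defect_star_eq_defect_adj: "defect_star T = defect (adj T)"
  by (rule defect_star_eq[OF bop_T])

lemma positive_D: "positive_op (defect T)"
  by (rule positive_defect[OF contraction_T])

lemma positive_Ds: "positive_op (defect_star T)"
  unfolding defect_star_eq_defect_adj by (rule positive_defect[OF contraction_adj[OF contraction_T]])

lemmas bop_D = positive_op_bop[OF positive_D]
lemmas bop_Ds = positive_op_bop[OF positive_Ds]

lemma cinner_D: "cinner (defect T x) y = cinner x (defect T y)"
  using cinner_adj[OF bop_D] positive_op_adj[OF positive_D] by simp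

lemma cinner_Ds: "cinner (defect_star T x) y = cinner x (defect_star T y)"
  using cinner_adj[OF bop_Ds] positive_op_adj[OF positive_Ds] by simp

lemma D_D: "defect T (defect T x) = x - adj T (T x)"
  by (rule defect_defect[OF contraction_T])

lemma Ds_Ds: "defect_star T (defect_star T y) = y - T (adj T y)"
  unfolding defect_star_eq_defect_adj
  by (simp add: defect_defect[OF contraction_adj[OF contraction_T]] adj_adj[OF bop_T])

lemma T_D: "T (defect T x) = defect_star T (T x)"
  by (rule defect_intertwine[OF contraction_T])

lemma adj_T_Ds: "adj T (defect_star T y) = defect T (adj T y)"
  using defect_intertwine[OF contraction_adj[OF contraction_T], of y]
  by (simp add: defect_star_eq_defect_adj defect_star_eq[OF bop_adj_T] adj_adj[OF bop_T])

lemma closure_range_D: "closure (range (defect T)) = ortho (kernel (defect T))"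
  by (rule closure_range_selfadjoint[OF bop_D positive_op_adj[OF positive_D]])

lemma closure_range_Ds: "closure (range (defect_star T)) = ortho (kernel (defect_star T))"
  by (rule closure_range_selfadjoint[OF bop_Ds positive_op_adj[OF positive_Ds]])

lemma D_mem: "defect T x \<in> closure (range (defect T))"
  by (rule subsetD[OF closure_subset rangeI])

lemma Ds_mem: "defect_star T y \<in> closure (range (defect_star T))"
  by (rule subsetD[OF closure_subset rangeI])

lemma subspace_closure_range_D: "complex_vector.subspace (closure (range (defect T)))"
  by (rule subspace_closure[OF subspace_range[OF bop_D]])

lemma subspace_closure_range_Ds: "complex_vector.subspace (closure (range (defect_star T)))"
  by (rule subspace_closure[OF subspace_range[OF bop_Ds]])

text \<open>On the kernel of its defect operator \<open>T\<close> is isometric. Together with the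
  next lemma, \<open>T\<close> and \<open>adj T\<close> restrict to mutually inverse isometries
  between the kernels of the two defect operators.\<close>

lemma
  assumes "n \<in> kernel (defect T)"
  shows adj_T_T_kernel: "adj T (T n) = n"
    and T_kernel: "T n \<in> kernel (defect_star T)"
proof -
  have n: "defect T n = 0"
    using assms by (simp add: kernel_def)
  then show "adj T (T n) = n"
    using D_D[of n] bop_zero[OF bop_D] by simp
  show "T n \<in> kernel (defect_star T)"
    using T_D[of n] bop_zero[OF bop_T] n by (simp add: kernel_def)
qed

lemma
  assumes "k \<in> kernel (defect_star T)"
  shows T_adj_T_kernel: "T (adj T k) = k"
    and adj_T_kernel: "adj T k \<in> kernel (defect T)"
proof -
  have k: "defect_star T k = 0"
    using assms by (simp add: kernel_def)
  then show "T (adj T k) = k"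
    using Ds_Ds[of k] bop_zero[OF bop_Ds] by simp
  show "adj T k \<in> kernel (defect T)"
    using adj_T_Ds[of k] bop_zero[OF bop_adj_T] k by (simp add: kernel_def)
qed

lemma T_image_kernel: "T ` kernel (defect T) = kernel (defect_star T)"
proof
  show "kernel (defect_star T) \<subseteq> T ` kernel (defect T)"
    using T_adj_T_kernel adj_T_kernel by (metis image_eqI subsetI)
qed (use T_kernel in blast)

text \<open>Dual to \<open>adj_T_kernel\<close>: \<open>adj T\<close> respects the two kernels, so
  \<open>T\<close> respects their orthogonal complements, the defect spaces.\<close>

lemma T_mem:
  assumes "x \<in> closure (range (defect T))"
  shows "T x \<in> closure (range (defect_star T))"
proof -
  have "cinner (T x) k = 0" if "k \<in> kernel (defect_star T)" for k
    unfolding cinner_adj[OF bop_T] by (rule orthoD[OF assms[unfolded closure_range_D] adj_T_kernel[OF that]])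
  then show ?thesis
    by (simp add: closure_range_Ds ortho_def)
qed

lemma adj_T_mem:
  assumes "y \<in> closure (range (defect_star T))"
  shows "adj T y \<in> closure (range (defect T))"
proof -
  have "cinner (adj T y) n = 0" if "n \<in> kernel (defect T)" for n
    unfolding cinner_adj'[OF bop_T, symmetric]
    by (rule orthoD[OF assms[unfolded closure_range_Ds] T_kernel[OF that]])
  then show ?thesis
    by (simp add: closure_range_D ortho_def)
qed

section \<open>Resolvents\<close>

lemma
  assumes "z \<in> unit_ball"
  shows bop_resolvent: "bop (resolvent z)"
    and resolvent_eq: "resolvent z h - row z (adj T (resolvent z h)) = h"
    and resolvent_eqI: "k - row z (adj T k) = h \<Longrightarrow> resolvent z h = k"
proof -
  have L: "bop (\<lambda>h. row z (adj T h))"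
    by (rule bop_comp[OF bop_row bop_adj_T])
  have le: "norm (row z (adj T h)) \<le> norm z * norm h" for h
    using norm_row[of z "adj T h"] mult_left_mono[OF norm_adj_T[of h] norm_ge_zero[of z]] by linarith
  have z: "0 \<le> norm z" "norm z < 1"
    using assms by auto
  note bij = neumann_bij[OF L z le]
  show "bop (resolvent z)"
    unfolding resolvent_def by (rule neumann_bop[OF L z le])
  show "resolvent z h - row z (adj T (resolvent z h)) = h"
    unfolding resolvent_def by (rule surj_f_inv_f[OF bij_is_surj[OF bij]])
  show "resolvent z h = k" if "k - row z (adj T k) = h"
    unfolding resolvent_def using bij_is_inj[OF bij] that by (rule inv_f_eq)
qed

lemma
  assumes "z \<in> unit_ball"
  shows coresolvent_eq: "coresolvent z h - T (col z (coresolvent z h)) = h"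
proof -
  have L: "bop (\<lambda>h. T (col z h))"
    by (rule bop_comp[OF bop_T bop_col])
  have le: "norm (T (col z h)) \<le> norm z * norm h" for h
    using norm_T[of "col z h"] by (simp add: norm_col)
  have z: "0 \<le> norm z" "norm z < 1"
    using assms by auto
  show "coresolvent z h - T (col z (coresolvent z h)) = h"
    unfolding coresolvent_def by (rule surj_f_inv_f[OF bij_is_surj[OF neumann_bij[OF L z le]]])
qed

lemma cinner_resolvent:
  assumes z: "z \<in> unit_ball"
  shows "cinner (resolvent z k) h = cinner k (coresolvent z h)"
proof -
  let ?r = "resolvent z k" and ?c = "coresolvent z h"
  have "cinner ?r h = cinner ?r ?c - cinner ?r (T (col z ?c))"
    using coresolvent_eq[OF z, of h] by (metis cinner_diff_right)
  also have "cinner ?r (T (col z ?c)) = cinner (row z (adj T ?r)) ?c"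
    using cinner_col[of z ?c "adj T ?r"] cinner_commute
    by (metis cinner_adj'[OF bop_T])
  also have "cinner ?r ?c - \<dots> = cinner k ?c"
    using resolvent_eq[OF z, of k] by (metis cinner_diff_left)
  finally show ?thesis .
qed

section \<open>The function \<Theta> and its adjoint\<close>

lemma theta_eq: "sz_nagy_foias T z x = defect_star T (resolvent z (row z (defect T x))) - T x"
  by (simp add: sz_nagy_foias_def resolvent_def)

lemma bop_theta:
  assumes "z \<in> unit_ball"
  shows "bop (sz_nagy_foias T z)"
proof -
  have "bop (\<lambda>x. defect_star T (resolvent z (row z (defect T x))) - T x)"
    by (rule bop_subtract[OF bop_comp[OF bop_Ds bop_comp[OF bop_resolvent[OF assms]
        bop_comp[OF bop_row bop_D]]] bop_T])
  then show ?thesis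
    by (simp add: theta_eq[abs_def])
qed

lemma theta_mem:
  assumes "x \<in> closure (range (defect T))"
  shows "sz_nagy_foias T z x \<in> closure (range (defect_star T))"
  unfolding theta_eq
  by (rule complex_vector.subspace_diff[OF subspace_closure_range_Ds Ds_mem T_mem[OF assms]])

lemma theta_adj_mem:
  assumes "y \<in> closure (range (defect_star T))"
  shows "theta_adj z y \<in> closure (range (defect T))"
  unfolding theta_adj_def
  by (rule complex_vector.subspace_diff[OF subspace_closure_range_D D_mem adj_T_mem[OF assms]])

lemma cinner_theta:
  assumes "z \<in> unit_ball"
  shows "cinner (sz_nagy_foias T z x) y = cinner x (theta_adj z y)"
proof -
  have "cinner (row z u) v = cinner u (col z v)" for u and v :: 'h
    by (metis cinner_col cinner_commute)
  then show ?thesis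
    by (simp add: theta_eq theta_adj_def cinner_diff_left cinner_diff_right cinner_Ds cinner_D
        cinner_resolvent[OF assms] cinner_adj[OF bop_T])
qed

text \<open>With c = \<open>col w h\<close> the coresolvent equation reads
  \<open>defect_star T y = h - T c\<close>. Expanding by the defect identities leaves the inner
  product of h and h' minus that of c and c', and the latter is a scalar multiple of the
  former.\<close>

lemma theta_adj_gram:
  assumes w: "w \<in> unit_ball" and z: "z \<in> unit_ball"
  shows "cinner y y' - cinner (theta_adj w y) (theta_adj z y')
    = (1 - (\<Sum>j\<in>UNIV. z $ j * cnj (w $ j)))
      * cinner (coresolvent w (defect_star T y)) (coresolvent z (defect_star T y'))"
proof -
  define h h' where "h = coresolvent w (defect_star T y)" and "h' = coresolvent z (defect_star T y')"
  define c c' where "c = col w h" and "c' = col z h'"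
  have p: "defect_star T y = h - T c" "defect_star T y' = h' - T c'"
    using coresolvent_eq[OF w] coresolvent_eq[OF z] by (simp_all add: h_def h'_def c_def c'_def)
  have "cinner (theta_adj w y) (theta_adj z y')
      = cinner (defect T c) (defect T c') - cinner (defect T c) (adj T y')
        - cinner (adj T y) (defect T c') + cinner (adj T y) (adj T y')"
    by (simp add: theta_adj_def h_def h'_def c_def c'_def cinner_diff_left cinner_diff_right)
  also have "cinner (defect T c) (defect T c') = cinner c c' - cinner (T c) (T c')"
    by (simp add: cinner_D D_D cinner_diff_right cinner_adj[OF bop_T])
  \<comment> \<open>\<open>T_D\<close> turns the defect operator into \<open>defect_star T\<close>,
    which is then moved onto \<open>y'\<close>.\<close>
  also have "cinner (defect T c) (adj T y') = cinner (T c) (h' - T c')"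
    by (simp add: cinner_adj[OF bop_T, symmetric] T_D cinner_Ds p)
  also have "cinner (adj T y) (defect T c') = cinner (h - T c) (T c')"
    by (simp add: cinner_adj'[OF bop_T, symmetric] T_D cinner_Ds[symmetric] p)
  also have "cinner (adj T y) (adj T y') = cinner y y' - cinner (h - T c) (h' - T c')"
  proof -
    have "cinner (h - T c) (h' - T c') = cinner y (y' - T (adj T y'))"
      by (metis p cinner_Ds Ds_Ds)
    then show ?thesis
      by (simp add: cinner_diff_right cinner_adj'[OF bop_T])
  qed
  finally have "cinner y y' - cinner (theta_adj w y) (theta_adj z y') = cinner h h' - cinner c c'"
    by (simp add: cinner_diff_left cinner_diff_right)
  then show ?thesis
    by (simp add: c_def c'_def cinner_col_col h_def h'_def algebra_simps)
qed

lemma theta_schur_class: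
  "sz_nagy_foias T \<in> schur_class (closure (range (defect T))) (closure (range (defect_star T)))"
proof (rule schur_classI[where Bst = theta_adj and \<Gamma> = "\<lambda>w y. coresolvent w (defect_star T y)"])
  fix z :: "complex ^ 'd"
  assume "z \<in> unit_ball"
  from bop_theta[OF this]
  show "sz_nagy_foias T z \<in> bounded_ops (closure (range (defect T))) (closure (range (defect_star T)))"
    using theta_mem by (auto simp: bounded_ops_def)
qed (simp_all only: subspace_closure_range_Ds theta_adj_mem cinner_theta theta_adj_gram)

text \<open>\<open>T\<close> is injective on the kernel of \<open>defect T\<close>, so the isometric
  part vanishes exactly on the orthogonal complement. This translates the spaces of a model triple
  into the defect spaces of \<open>T\<close>.\<close>

lemma
  shows ortho_kernel_isometric_part: "ortho (kernel (isometric_part T)) = kernel (defect T)"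
    and kernel_isometric_part: "kernel (isometric_part T) = closure (range (defect T))"
    and isometric_part_eq: "n \<in> kernel (defect T) \<Longrightarrow> isometric_part T n = T n"
proof -
  let ?N = "kernel (defect T)"
  note N = subspace_kernel[OF bop_D] closed_kernel[OF bop_D]
  have "T (proj ?N x) = 0 \<longleftrightarrow> x \<in> ortho ?N" for x
  proof
    assume "T (proj ?N x) = 0"
    then have "proj ?N x = 0"
      using adj_T_T_kernel[OF proj_mem[OF N, of x]] bop_zero[OF bop_adj_T] by simp
    then show "x \<in> ortho ?N"
      using proj_ortho[OF N, of x] by simp
  next
    assume "x \<in> ortho ?N"
    then have "proj ?N x = 0"
      by (intro proj_eqI[OF N(1)]) (simp_all add: complex_vector.subspace_0[OF N(1)])
    then show "T (proj ?N x) = 0"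
      by (simp add: bop_zero[OF bop_T])
  qed
  then have *: "kernel (isometric_part T) = ortho ?N"
    by (auto simp: kernel_def isometric_part_def)
  then show "kernel (isometric_part T) = closure (range (defect T))"
    by (simp add: closure_range_D)
  show "ortho (kernel (isometric_part T)) = ?N"
    unfolding * by (rule ortho_ortho[OF N])
  show "isometric_part T n = T n" if "n \<in> ?N"
  proof -
    have "proj ?N n = n"
      using that by (intro proj_eqI[OF N(1)]) (simp_all add: complex_vector.subspace_0[OF subspace_ortho])
    then show ?thesis
      by (simp add: isometric_part_def)
  qed
qed

lemma range_minus_isometric_part:
  "range_minus (isometric_part T) z = (\<lambda>n. T n - row z n) ` kernel (defect T)"
  unfolding range_minus_def ortho_kernel_isometric_part
  by (rule image_cong) (simp_all add: isometric_part_eq)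

end

section \<open>The characteristic function of a model triple\<close>

locale row_contractive_model = row_contractive T
  for T :: "'h::complex_hilbert_space ^ 'd::finite \<Rightarrow> 'h" +
  fixes \<gamma> :: "complex ^ 'd \<Rightarrow> 'j::complex_hilbert_space \<Rightarrow> 'h"
    and \<gamma>i :: "'i::complex_hilbert_space \<Rightarrow> 'h ^ 'd"
  assumes model: "model_triple (isometric_part T) \<gamma> \<gamma>i"
begin

abbreviation Q :: "'h \<Rightarrow> 'h"
  where "Q k \<equiv> \<gamma> 0 (adj (\<gamma> 0) k)"

text \<open>At z = 0 the subspace \<open>range_minus\<close> is the image under \<open>T\<close> of
  the kernel of \<open>defect T\<close>, that is, the kernel of
  \<open>defect_star T\<close>.\<close>

lemma iso0: "onto_isometry UNIV (closure (range (defect_star T))) (\<gamma> 0)"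
proof -
  have "row 0 n = 0" for n :: "'h ^ 'd"
    by (simp add: row_eq)
  then have "range_minus (isometric_part T) 0 = kernel (defect_star T)"
    by (simp add: range_minus_isometric_part T_image_kernel)
  then show ?thesis
    using model by (simp add: model_triple_def closure_range_Ds)
qed

lemma isoi: "onto_isometry UNIV (closure (range (defect T))) \<gamma>i"
  using model by (simp add: model_triple_def kernel_isometric_part)

lemmas bop0 = onto_isometry_bop[OF iso0] and mem0 = onto_isometry_mem[OF iso0]
  and adj0_left = onto_isometry_adj_left[OF iso0] and Q_id = onto_isometry_adj_right[OF iso0]
  and bopi = onto_isometry_bop[OF isoi] and memi = onto_isometry_mem[OF isoi]
  and adji_left = onto_isometry_adj_left[OF isoi] and adji_right = onto_isometry_adj_right[OF isoi]

lemma diff_Q_mem: "k - Q k \<in> kernel (defect_star T)"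
  using onto_isometry_ortho[OF iso0] ortho_ortho[OF subspace_kernel[OF bop_Ds] closed_kernel[OF bop_Ds]]
  by (simp add: closure_range_Ds)

lemma Ds_Q: "defect_star T (Q k) = defect_star T k"
  using diff_Q_mem[of k] by (simp add: kernel_def bop_diff[OF bop_Ds])

lemma bop_Q: "bop (\<lambda>k. Q k)"
  by (rule bop_comp[OF bop0 bop_adj[OF bop0]])

lemma norm_diff_Q: "norm (k - Q k) \<le> norm k"
  by (rule onto_isometry_norm_diff[OF iso0])

section \<open>The maps \<gamma>(z) and the function of the isometric part\<close>

lemma
  assumes "z \<in> unit_ball"
  shows bop_gamma: "bop (\<gamma> z)"
    and range_gamma: "range (\<gamma> z) = ortho ((\<lambda>n. T n - row z n) ` kernel (defect T))"
proof -
  have "\<gamma> z \<in> bounded_ops UNIV (ortho (range_minus (isometric_part T) z))"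
    "bij_betw (\<gamma> z) UNIV (ortho (range_minus (isometric_part T) z))"
    using model assms by (auto simp: model_triple_def)
  then show "bop (\<gamma> z)" "range (\<gamma> z) = ortho ((\<lambda>n. T n - row z n) ` kernel (defect T))"
    using bounded_ops_mono_range[of "\<gamma> z" UNIV _ UNIV] by (auto simp: bij_betw_def range_minus_isometric_part)
qed

lemma adj_gamma_minus:
  assumes z: "z \<in> unit_ball" and n: "n \<in> kernel (defect T)"
  shows "adj (\<gamma> z) (T n - row z n) = 0"
proof (rule adj_eqI)
  fix u
  have "\<gamma> z u \<in> ortho ((\<lambda>n. T n - row z n) ` kernel (defect T))"
    using range_gamma[OF z] by blast
  from orthoD[OF this imageI[OF n]] show "cinner (\<gamma> z u) (T n - row z n) = cinner u 0"
    by simp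
qed

text \<open>With \<open>V\<close> the isometric part of \<open>T\<close>, the vector \<open>v = (I - Vz\<^sup>*)\<^sup>-\<^sup>1\<gamma>(0)c\<close> lies in the range of
  \<open>\<gamma>(z)\<close> and satisfies \<open>\<langle>\<gamma>(0)c, v\<rangle> = \<parallel>c\<parallel>\<^sup>2\<close>.\<close>

lemma inj_dgam:
  assumes z: "z \<in> unit_ball"
  shows "inj (dgam \<gamma> z)"
proof -
  have D: "bop (\<lambda>c. adj (\<gamma> z) (\<gamma> 0 c))"
    by (rule bop_comp[OF bop_adj[OF bop_gamma[OF z]] bop0])
  have "c = 0" if c: "adj (\<gamma> z) (\<gamma> 0 c) = 0" for c
  proof -
    \<comment> \<open>The operator V composed with \<open>col z\<close>: since \<open>T\<close>
      respects the kernels and the defect spaces, V is \<open>T\<close> followed by the projection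
      complementary to \<open>Q\<close>.\<close>
    define L where "L = (\<lambda>v. T (col z v) - Q (T (col z v)))"
    define v where "v = inv (\<lambda>v. v - L v) (\<gamma> 0 c)"
    have TC: "bop (\<lambda>v. T (col z v))"
      by (rule bop_comp[OF bop_T bop_col])
    have L: "bop L"
      unfolding L_def by (rule bop_subtract[OF TC bop_comp[OF bop_Q TC]])
    have L_le: "norm (L v) \<le> norm z * norm v" for v
      unfolding L_def using norm_diff_Q[of "T (col z v)"] norm_T[of "col z v"]
      by (simp add: norm_col)
    have v: "v - L v = \<gamma> 0 c"
      unfolding v_def using z
      by (intro surj_f_inv_f[OF bij_is_surj[OF neumann_bij[OF L _ _ L_le]]]) auto
    have e_ortho: "cinner (\<gamma> 0 c) k = 0" if "k \<in> kernel (defect_star T)" for k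
      by (rule orthoD[OF mem0[unfolded closure_range_Ds] that])
    \<comment> \<open>So \<open>v\<close> is orthogonal to the range of V - z: vectors in the range
      of \<open>\<gamma> 0\<close> are orthogonal to \<open>T n\<close>, and
      \<open>adj T (T n) = n\<close>.\<close>
    have "cinner v (T n - row z n) = 0" if n: "n \<in> kernel (defect T)" for n
    proof -
      have "cinner v (T n) = cinner (\<gamma> 0 c) (T n) + cinner (L v) (T n)"
        using v by (metis cinner_add_left diff_add_cancel)
      also have "\<dots> = cinner (T (col z v)) (T n) - cinner (Q (T (col z v))) (T n)"
        by (simp add: e_ortho[OF T_kernel[OF n]] L_def cinner_diff_left)
      also have "cinner (Q (T (col z v))) (T n) = 0"
        by (rule orthoD[OF mem0[unfolded closure_range_Ds] T_kernel[OF n]])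
      also have "cinner (T (col z v)) (T n) = cinner (col z v) n"
        by (simp add: cinner_adj[OF bop_T] adj_T_T_kernel[OF n])
      finally show ?thesis
        by (simp add: cinner_diff_right cinner_col)
    qed
    then have "v \<in> range (\<gamma> z)"
      unfolding range_gamma[OF z] by (auto simp: ortho_def)
    then obtain c' where "v = \<gamma> z c'"
      by blast
    then have "cinner (\<gamma> 0 c) v = 0"
      using c by (simp add: cinner_adj'[OF bop_gamma[OF z]])
    moreover have "cinner (\<gamma> 0 c) v = cinner (\<gamma> 0 c) (\<gamma> 0 c) + cinner (\<gamma> 0 c) (L v)"
      using v by (metis cinner_add_right diff_add_cancel)
    moreover have "cinner (\<gamma> 0 c) (L v) = 0"
      unfolding L_def by (rule e_ortho[OF diff_Q_mem])
    ultimately have "cinner c c = 0"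
      by (simp only: onto_isometry_cinner[OF iso0]) simp
    then show "c = 0"
      by (simp add: cinner_self)
  qed
  then show ?thesis
    using linear_injective_0[OF bop_linear[OF D]] by (simp add: dgam_def comp_def)
qed

text \<open>For n = \<open>adj T (k - Q k)\<close>, which lies in the kernel of
  \<open>defect T\<close>, one has T n = k - Q k. The hypothesis thus splits
  \<open>row z (\<gamma>i g)\<close> into \<open>Q k\<close> and \<open>T n - row z n\<close>, and
  the adjoint of \<open>\<gamma> z\<close> annihilates the second term.\<close>

lemma char_fun_V_eq:
  assumes z: "z \<in> unit_ball" and k: "k - row z (adj T (k - Q k)) = row z (\<gamma>i g)"
  shows "char_fun_V \<gamma> \<gamma>i z g = adj (\<gamma> 0) k"
proof -
  note A = bop_adj[OF bop_gamma[OF z]]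
  have "row z (ngam \<gamma> \<gamma>i z g) = adj (\<gamma> z) (row z (\<gamma>i g))"
    by (simp add: row_eq ngam_def linear_sum[OF bop_linear[OF A]] bop_scaleC[OF A])
  also have "row z (\<gamma>i g) = Q k + (T (adj T (k - Q k)) - row z (adj T (k - Q k)))"
    using k by (simp add: T_adj_T_kernel[OF diff_Q_mem] algebra_simps)
  also have "adj (\<gamma> z) \<dots> = dgam \<gamma> z (adj (\<gamma> 0) k)"
    by (simp add: bop_add[OF A] adj_gamma_minus[OF z adj_T_kernel[OF diff_Q_mem]] dgam_def)
  finally show ?thesis
    by (simp add: char_fun_V_def inv_f_f[OF inj_dgam[OF z]])
qed

lemma ex_char_fun_V:
  assumes z: "z \<in> unit_ball"
  obtains k where "k - row z (adj T (k - Q k)) = row z (\<gamma>i g)" "char_fun_V \<gamma> \<gamma>i z g = adj (\<gamma> 0) k"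
proof -
  have L: "bop (\<lambda>k. row z (adj T (k - Q k)))"
    by (rule bop_comp[OF bop_row bop_comp[OF bop_adj_T bop_subtract[OF bop_id bop_Q]]])
  have le: "norm (row z (adj T (k - Q k))) \<le> norm z * norm k" for k
  proof -
    have "norm (adj T (k - Q k)) \<le> norm k"
      using norm_adj_T norm_diff_Q order_trans by blast
    then show ?thesis
      using norm_row[of z "adj T (k - Q k)"] mult_left_mono[OF _ norm_ge_zero[of z]]
      by (meson order_trans)
  qed
  have "surj (\<lambda>k. k - row z (adj T (k - Q k)))"
    by (rule bij_is_surj[OF neumann_bij[OF L norm_ge_zero _ le]]) (use z in simp)
  from surjD[OF this, of "row z (\<gamma>i g)"]
  obtain k where k: "row z (\<gamma>i g) = k - row z (adj T (k - Q k))" ..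
  show thesis
    by (rule that[OF k[symmetric] char_fun_V_eq[OF z k[symmetric]]])
qed

section \<open>The contraction \<delta> and its defect operators\<close>

abbreviation \<delta> :: "'i \<Rightarrow> 'j"
  where "\<delta> \<equiv> delta T \<gamma> \<gamma>i"

lemma contraction_delta: "contraction \<delta>"
proof -
  have "norm (\<delta> g) \<le> norm g" for g
  proof -
    have a0: "norm (adj (\<gamma> 0) y) \<le> 1 * norm y" for y
      using bop0 iso0 by (intro norm_adj_le) (auto simp: onto_isometry_def)
    have "norm (\<delta> g) \<le> norm (T (\<gamma>i g))"
      using a0 by (simp add: delta_def)
    also have "\<dots> \<le> norm (\<gamma>i g)"
      by (rule norm_T)
    also have "\<dots> = norm g"
      using isoi by (auto simp: onto_isometry_def)
    finally show ?thesis .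
  qed
  moreover have "bop \<delta>"
    unfolding delta_def
    by (rule bop_uminus[OF bop_comp[OF bop_adj[OF bop0] bop_comp[OF bop_T bopi]]])
  ultimately show ?thesis
    by blast
qed

lemma adj_delta: "adj \<delta> c = - adj \<gamma>i (adj T (\<gamma> 0 c))"
proof (rule adj_eqI)
  fix u
  show "cinner (\<delta> u) c = cinner u (- adj \<gamma>i (adj T (\<gamma> 0 c)))"
    by (simp add: delta_def cinner_minus_left cinner_minus_right cinner_adj'[OF bop0, symmetric]
        cinner_adj[OF bop_T] cinner_adj[OF bopi])
qed

text \<open>Up to sign, \<open>\<delta>\<close> is \<open>T\<close> between its defect spaces,
  transported by the isometries. Since \<open>T\<close> and \<open>adj T\<close> respect these
  spaces, the compression of \<open>defect T\<close> squares correctly, and the positive root is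
  unique.\<close>

lemma defect_delta: "defect \<delta> = (\<lambda>x. adj \<gamma>i (defect T (\<gamma>i x)))"
proof (rule defect_unique[OF contraction_delta positive_op_compress[OF bopi positive_D]])
  show "adj \<gamma>i (defect T (\<gamma>i (adj \<gamma>i (defect T (\<gamma>i x))))) = x - adj \<delta> (\<delta> x)" for x
    by (simp add: adji_right[OF D_mem] D_D bop_diff[OF bop_adj[OF bopi]] adji_left adj_delta)
      (simp add: delta_def bop_minus[OF bop0] bop_minus[OF bop_adj_T] bop_minus[OF bop_adj[OF bopi]]
        Q_id[OF T_mem[OF memi]])
qed

lemma
  shows positive_defect_star_delta: "positive_op (defect_star \<delta>)"
    and defect_star_delta: "defect_star \<delta> = (\<lambda>y. adj (\<gamma> 0) (defect_star T (\<gamma> 0 y)))"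
proof -
  have \<delta>: "bop \<delta>"
    using contraction_delta by blast
  show "positive_op (defect_star \<delta>)"
    unfolding defect_star_eq[OF \<delta>] by (rule positive_defect[OF contraction_adj[OF contraction_delta]])
  show "defect_star \<delta> = (\<lambda>y. adj (\<gamma> 0) (defect_star T (\<gamma> 0 y)))"
    unfolding defect_star_eq[OF \<delta>]
  proof (rule defect_unique[OF contraction_adj[OF contraction_delta]
        positive_op_compress[OF bop0 positive_Ds]])
    show "adj (\<gamma> 0) (defect_star T (\<gamma> 0 (adj (\<gamma> 0) (defect_star T (\<gamma> 0 y)))))
        = y - adj (adj \<delta>) (adj \<delta> y)" for y
      unfolding adj_adj[OF \<delta>]
      by (simp add: Q_id[OF Ds_mem] Ds_Ds bop_diff[OF bop_adj[OF bop0]] adj0_left adj_delta)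
        (simp add: delta_def bop_minus[OF bopi] bop_minus[OF bop_T] bop_minus[OF bop_adj[OF bop0]]
          adji_right[OF adj_T_mem[OF mem0]])
  qed
qed

text \<open>A vector y in the kernel would put \<open>\<gamma> 0 y\<close> both in the kernel of
  \<open>defect_star T\<close> and in its orthogonal complement.\<close>

lemma inj_defect_star_delta: "inj (defect_star \<delta>)"
proof -
  have "y = 0" if "defect_star \<delta> y = 0" for y
  proof -
    have "Q (defect_star T (\<gamma> 0 y)) = 0"
      using that bop_zero[OF bop0] by (simp add: defect_star_delta)
    then have "\<gamma> 0 y \<in> kernel (defect_star T)"
      by (simp add: Q_id[OF Ds_mem] kernel_def)
    then have "cinner (\<gamma> 0 y) (\<gamma> 0 y) = 0"
      by (rule orthoD[OF mem0[unfolded closure_range_Ds]])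
    then have "cinner y y = 0"
      by (simp only: onto_isometry_cinner[OF iso0])
    then show "y = 0"
      by (simp add: cinner_self)
  qed
  then show ?thesis
    using linear_injective_0[OF bop_linear[OF positive_op_bop[OF positive_defect_star_delta]]] by blast
qed

text \<open>Adding \<open>row z (adj T (Q k))\<close> to both sides of the resolvent equation for
  \<open>k\<close> gives the equation of \<open>char_fun_V_eq\<close> for this \<open>g\<close>. The
  term by which \<open>g\<close> exceeds \<open>u\<close> is exactly what
  \<open>adj \<delta>\<close> of the value subtracts.\<close>

lemma
  fixes u :: 'i
  assumes z: "z \<in> unit_ball"
  defines "k \<equiv> resolvent z (row z (\<gamma>i u))"
  defines "g \<equiv> u + adj \<gamma>i (adj T (Q k))"
  shows inv_one_plus: "inv (\<lambda>g. g + adj \<delta> (char_fun_V \<gamma> \<gamma>i z g)) u = g"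
    and char_fun_V_inv: "char_fun_V \<gamma> \<gamma>i z g = adj (\<gamma> 0) k"
    and gamma_inv: "\<gamma>i g = \<gamma>i u + adj T (Q k)"
proof -
  let ?f = "\<lambda>g. g + adj \<delta> (char_fun_V \<gamma> \<gamma>i z g)"
  \<comment> \<open>A left inverse of \<open>?f\<close>, used for injectivity, so that
    \<open>inv\<close> returns the preimage found below.\<close>
  let ?W = "\<lambda>u. u + adj \<gamma>i (adj T (Q (resolvent z (row z (\<gamma>i u)))))"
  have ii: "\<gamma>i (adj \<gamma>i (adj T (Q k))) = adj T (Q k)" for k
    by (rule adji_right[OF adj_T_mem[OF mem0]])
  have "?W (?f g) = g" for g
  proof -
    obtain k where k: "k - row z (adj T (k - Q k)) = row z (\<gamma>i g)"
      and b: "char_fun_V \<gamma> \<gamma>i z g = adj (\<gamma> 0) k"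
      using ex_char_fun_V[OF z] by blast
    have f: "?f g = g - adj \<gamma>i (adj T (Q k))"
      by (simp add: b adj_delta)
    have "k - row z (adj T k) = row z (\<gamma>i (?f g))"
      using k by (simp only: f bop_diff[OF bopi] ii bop_diff[OF bop_row] bop_diff[OF bop_adj_T])
        (simp add: algebra_simps)
    then have "resolvent z (row z (\<gamma>i (?f g))) = k"
      by (rule resolvent_eqI[OF z])
    then show ?thesis
      by (simp add: f)
  qed
  then have inj: "inj ?f"
    by (rule inj_on_inverseI)
  show gi: "\<gamma>i g = \<gamma>i u + adj T (Q k)"
    by (simp add: g_def bop_add[OF bopi] ii)
  have "k - row z (adj T k) = row z (\<gamma>i u)"
    unfolding k_def by (rule resolvent_eq[OF z])
  then have "k - row z (adj T (k - Q k)) = row z (\<gamma>i g)"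
    by (simp add: gi bop_add[OF bop_row] bop_diff[OF bop_row] bop_diff[OF bop_adj_T] algebra_simps)
  then show b: "char_fun_V \<gamma> \<gamma>i z g = adj (\<gamma> 0) k"
    by (rule char_fun_V_eq[OF z])
  have "?f g = u"
    by (simp add: b adj_delta) (simp add: g_def)
  then show "inv ?f u = g"
    by (rule inv_f_eq[OF inj])
qed

section \<open>Identification of the characteristic function\<close>

lemma bop_compressed_theta:
  assumes z: "z \<in> unit_ball"
  shows "bop (\<lambda>g. adj (\<gamma> 0) (sz_nagy_foias T z (\<gamma>i g)))"
  by (rule bop_comp[OF bop_adj[OF bop0] bop_comp[OF bop_theta[OF z] bopi]])

lemma char_fun_factor:
  assumes z: "z \<in> unit_ball"
  defines "g' \<equiv> \<lambda>g. inv (\<lambda>g. g + adj \<delta> (char_fun_V \<gamma> \<gamma>i z g)) (defect \<delta> g)"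
  shows "char_fun_V \<gamma> \<gamma>i z (g' g) + \<delta> (g' g)
    = defect_star \<delta> (adj (\<gamma> 0) (sz_nagy_foias T z (\<gamma>i g)))"
proof -
  define k where "k = resolvent z (row z (\<gamma>i (defect \<delta> g)))"
  note A = bop_adj[OF bop0]
  have u: "\<gamma>i (defect \<delta> g) = defect T (\<gamma>i g)"
    by (simp add: defect_delta adji_right[OF D_mem])
  have g': "\<gamma>i (g' g) = defect T (\<gamma>i g) + adj T (Q k)"
    unfolding g'_def inv_one_plus[OF z] u[symmetric] k_def by (rule gamma_inv[OF z])
  have "char_fun_V \<gamma> \<gamma>i z (g' g) = adj (\<gamma> 0) (Q k)"
    unfolding g'_def inv_one_plus[OF z] char_fun_V_inv[OF z] adj0_left k_def ..
  then have "char_fun_V \<gamma> \<gamma>i z (g' g) + \<delta> (g' g)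
      = adj (\<gamma> 0) (Q k - T (adj T (Q k)) - T (defect T (\<gamma>i g)))"
    by (simp add: delta_def g' bop_add[OF bop_T] bop_add[OF A] bop_diff[OF A])
  \<comment> \<open>\<open>defect_star T\<close> vanishes on \<open>k - Q k\<close>, so the
    projection may be dropped.\<close>
  also have "Q k - T (adj T (Q k)) = defect_star T (defect_star T k)"
    by (simp add: Ds_Ds[symmetric] Ds_Q)
  also have "defect_star T (defect_star T k) - T (defect T (\<gamma>i g))
      = defect_star T (sz_nagy_foias T z (\<gamma>i g))"
    by (simp add: T_D theta_eq bop_diff[OF bop_Ds] k_def u)
  also have "adj (\<gamma> 0) \<dots> = defect_star \<delta> (adj (\<gamma> 0) (sz_nagy_foias T z (\<gamma>i g)))"
    by (simp add: defect_star_delta Ds_Q)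
  finally show ?thesis .
qed

text \<open>By the factorisation, the compression of \<Theta> satisfies the defining condition of
  \<open>char_fun\<close>. Any other solution has the same product with the self-adjoint
  \<open>defect_star \<delta>\<close>, which is injective.\<close>

lemma char_fun_eq:
  assumes z: "z \<in> unit_ball"
  shows "char_fun T \<gamma> \<gamma>i z = (\<lambda>g. adj (\<gamma> 0) (sz_nagy_foias T z (\<gamma>i g)))"
proof -
  let ?B = "\<lambda>g. adj (\<gamma> 0) (sz_nagy_foias T z (\<gamma>i g))"
  note B = bop_compressed_theta[OF z]
  note D = positive_op_bop[OF positive_defect_star_delta]
  have X: "(\<lambda>g. char_fun_V \<gamma> \<gamma>i z g + \<delta> g) \<circ> inv (\<lambda>g. g + adj \<delta> (char_fun_V \<gamma> \<gamma>i z g)) \<circ> defect \<delta>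
      = (\<lambda>g. defect_star \<delta> (?B g))"
    using char_fun_factor[OF z] by (simp add: fun_eq_iff)
  have adjX: "adj (\<lambda>g. defect_star \<delta> (?B g)) (inv (defect_star \<delta>) (defect_star \<delta> y))
      = adj ?B (defect_star \<delta> y)" for y
    by (simp only: adj_comp[OF D B] inv_f_f[OF inj_defect_star_delta]
        positive_op_adj[OF positive_defect_star_delta])
  show ?thesis
    unfolding char_fun_def Let_def X
  proof (rule the_equality)
    show "bop ?B \<and> (\<forall>y\<in>range (defect_star \<delta>). adj ?B y
        = adj (\<lambda>g. defect_star \<delta> (?B g)) (inv (defect_star \<delta>) y))"
      using B adjX by auto
    fix B'
    assume "bop B' \<and> (\<forall>y\<in>range (defect_star \<delta>). adj B' y
        = adj (\<lambda>g. defect_star \<delta> (?B g)) (inv (defect_star \<delta>) y))"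
    then have B': "bop B'" and eq: "adj B' (defect_star \<delta> y) = adj ?B (defect_star \<delta> y)" for y
      using adjX by auto
    have sa: "cinner (defect_star \<delta> x) y = cinner x (defect_star \<delta> y)" for x y
      using cinner_adj[OF D] positive_op_adj[OF positive_defect_star_delta] by simp
    show "B' = ?B"
    proof
      fix x
      have "cinner y (defect_star \<delta> (B' x)) = cinner y (defect_star \<delta> (?B x))" for y
      proof -
        have "cinner (B' x) (defect_star \<delta> y) = cinner (?B x) (defect_star \<delta> y)"
          by (simp only: cinner_adj[OF B'] cinner_adj[OF B] eq)
        then show ?thesis
          by (metis cinner_commute sa)
      qed
      then have "defect_star \<delta> (B' x) = defect_star \<delta> (?B x)"
        by (rule eq_if_cinner_eq[OF complex_vector.subspace_UNIV UNIV_I UNIV_I])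
      then show "B' x = ?B x"
        by (rule injD[OF inj_defect_star_delta])
    qed
  qed
qed

section \<open>Schur class membership and weak coincidence\<close>

lemma cinner_char_fun:
  assumes "w \<in> unit_ball"
  shows "cinner (char_fun T \<gamma> \<gamma>i w x) y = cinner x (adj \<gamma>i (theta_adj w (\<gamma> 0 y)))"
  by (simp add: char_fun_eq[OF assms] cinner_adj'[OF bop0, symmetric] cinner_theta[OF assms]
      cinner_adj[OF bopi])

lemma char_fun_schur_class: "char_fun T \<gamma> \<gamma>i \<in> schur_class UNIV UNIV"
proof (rule schur_classI[where Bst = "\<lambda>w y. adj \<gamma>i (theta_adj w (\<gamma> 0 y))"
      and \<Gamma> = "\<lambda>w y. coresolvent w (defect_star T (\<gamma> 0 y))"])
  show "bop (char_fun T \<gamma> \<gamma>i z)" if "z \<in> unit_ball" for z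
    unfolding char_fun_eq[OF that] by (rule bop_compressed_theta[OF that])
  fix w z :: "complex ^ 'd" and y y' :: 'j
  assume wz: "w \<in> unit_ball" "z \<in> unit_ball"
  \<comment> \<open>The values of \<open>theta_adj\<close> used here lie in the range of
    \<open>\<gamma>i\<close>, where \<open>adj \<gamma>i\<close> is isometric.\<close>
  have "cinner (adj \<gamma>i (theta_adj w (\<gamma> 0 y))) (adj \<gamma>i (theta_adj z (\<gamma> 0 y')))
      = cinner (theta_adj w (\<gamma> 0 y)) (theta_adj z (\<gamma> 0 y'))"
    by (simp add: onto_isometry_cinner[OF isoi, symmetric] adji_right theta_adj_mem[OF mem0])
  then show "cinner y y' - cinner (adj \<gamma>i (theta_adj w (\<gamma> 0 y))) (adj \<gamma>i (theta_adj z (\<gamma> 0 y')))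
      = (1 - (\<Sum>j\<in>UNIV. z $ j * cnj (w $ j)))
        * cinner (coresolvent w (defect_star T (\<gamma> 0 y))) (coresolvent z (defect_star T (\<gamma> 0 y')))"
    using theta_adj_gram[OF wz, of "\<gamma> 0 y" "\<gamma> 0 y'"] by (simp only: onto_isometry_cinner[OF iso0])
qed (simp_all add: cinner_char_fun)

text \<open>The isometries cancel because \<open>theta_adj w y\<close> lies in the range of
  \<open>\<gamma>i\<close> and the values of \<Theta> on the defect space lie in the range of
  \<open>\<gamma> 0\<close>.\<close>

lemma coincide:
  "coincide_weakly UNIV UNIV (char_fun T \<gamma> \<gamma>i)
    (closure (range (defect T))) (closure (range (defect_star T))) (sz_nagy_foias T)"
  unfolding coincide_weakly_def
proof (intro conjI exI[of _ "\<gamma> 0"] ballI)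
  fix z w :: "complex ^ 'd" and y
  assume z: "z \<in> unit_ball" and w: "w \<in> unit_ball" and y: "y \<in> closure (range (defect_star T))"
  have m: "theta_adj w y \<in> closure (range (defect T))"
    by (rule theta_adj_mem[OF y])
  have "adj (char_fun T \<gamma> \<gamma>i w) (adj (\<gamma> 0) y) = adj \<gamma>i (theta_adj w y)"
    by (rule adj_eqI) (simp add: cinner_char_fun[OF w] Q_id[OF y])
  moreover have "adj_on (closure (range (defect T))) (sz_nagy_foias T w) y = theta_adj w y"
    by (rule adj_on_eqI[OF subspace_closure_range_D m cinner_theta[OF w]])
  ultimately show "\<gamma> 0 (char_fun T \<gamma> \<gamma>i z (adj (char_fun T \<gamma> \<gamma>i w) (adj (\<gamma> 0) y)))
      = sz_nagy_foias T z (adj_on (closure (range (defect T))) (sz_nagy_foias T w) y)"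
    by (simp add: char_fun_eq[OF z] adji_right[OF m] Q_id[OF theta_mem[OF m]])
qed (fact char_fun_schur_class theta_schur_class iso0)+

end

theorem proposition5p15:
  fixes T :: "'h::{complex_hilbert_space, second_countable_topology} ^ 'd::finite \<Rightarrow> 'h"
    and \<gamma> :: "complex ^ 'd \<Rightarrow> 'j::{complex_hilbert_space, second_countable_topology} \<Rightarrow> 'h"
    and \<gamma>i :: "'i::{complex_hilbert_space, second_countable_topology} \<Rightarrow> 'h ^ 'd"
  assumes "row_contraction T" and "ccnc T"
    and "model_triple (isometric_part T) \<gamma> \<gamma>i"
  shows "coincide_weakly UNIV UNIV (char_fun T \<gamma> \<gamma>i)
    (closure (range (defect T))) (closure (range (defect_star T))) (sz_nagy_foias T)"
proof -
  interpret row_contractive_model T \<gamma> \<gamma>i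
    using assms by unfold_locales
  show ?thesis
    by (rule coincide)
qed

end
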